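(* Let $\alpha$ be an irrational number with $0<\alpha<\tfrac12$, with nearest integer continued fraction expansion $(a_i,\varepsilon_i)$, and let $\gamma_*$ and $R=\liminf_{i\to\infty}a_i$ be as defined in the context. Then $$\rho(\alpha)\ \ge\ M(\alpha,\gamma_* )\ \ge\ \begin{cases} \dfrac{1}{2(\sqrt{13}+10)}=\dfrac{1}{27.211\ldots}, & R=2,\\[2ex] \dfrac14\,(2-\sqrt3)\,\dfrac{1-\frac14\left(1+\frac{\theta^2}{1-\theta}\right)}{1+\frac14\left(\theta-\frac{\sqrt3-1}{2}\right)}=\dfrac{1}{20.487\ldots}, \ \ \theta=\tfrac{\sqrt{13}-3}{2}, & R=3,\\[2ex] \dfrac14\left(1-\dfrac3R+\dfrac4{R^2}-\dfrac7{R^3}\right), & R\ge 4 \text{ even},\\[2ex] \dfrac14\left(1-\dfrac3R+\dfrac3{R^2}-\dfrac6{R^3}\right), & R\ge 5 \text{ odd}.\end{cases}$$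
   Context: For real $x$, $\|x\|$ is the distance from $x$ to the nearest integer and $\{x\}$ its fractional part. For irrational $\alpha$ and real $\gamma$, $M(\alpha,\gamma):=\liminf_{|n|\to\infty,\,n\in\mathbb Z}|n|\,\|n\alpha-\gamma\|$, and $\rho(\alpha):=\sup\{M(\alpha,\gamma):\gamma\in\mathbb R,\ \gamma\notin\mathbb Z+\alpha\mathbb Z\}$. Nearest integer continued fraction expansion of irrational $\alpha\in(0,\tfrac12)$: put $a_0=0$, $\varepsilon_1=1$, $\alpha_0=\alpha$, and for $i\ge0$: if $\|1/\alpha_i\|=\{1/\alpha_i\}$ set $a_{i+1}=\lfloor 1/\alpha_i\rfloor$, $\varepsilon_{i+2}=+1$; otherwise set $a_{i+1}=\lceil 1/\alpha_i\rceil$, $\varepsilon_{i+2}=-1$; in both cases $\alpha_{i+1}=\|1/\alpha_i\|$. Then $a_i\ge2$ for $i\ge1$ and $\alpha=a_0+\cfrac{\varepsilon_1}{a_1+\cfrac{\varepsilon_2}{a_2+\cdots}}$. Convergents: $p_{-1}=1,q_{-1}=0,p_0=a_0,q_0=1$, $p_i=a_ip_{i-1}+\varepsilon_ip_{i-2}$, $q_i=a_iq_{i-1}+\varepsilon_iq_{i-2}$, and $D_i:=|q_i\alpha-p_i|$ ($i\ge0$). Let $\lambda_i=0$ if $a_i$ is even and $\lambda_i=(-1)^j$ if $a_i$ is the $j$-th odd term among $a_1,a_2,\dots$ ($j=1,2,\dots$). Define $\gamma_*:=\sum_{i\ge1}\tfrac12(a_i-1+\varepsilon_i+\lambda_i)D_{i-1}$.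 Here $R:=\liminf_{i\to\infty}a_i$ (the listed cases concern finite $R$). *)

theory Defs
  imports "HOL-Analysis.Analysis"
begin

definition nint_dist :: "real \<Rightarrow> real" where
  "nint_dist x = \<bar>x - of_int (round x)\<bar>"

text \<open>The lower limit is taken in the extended reals, along the filter of integers \<open>n\<close> with
  \<open>\<bar>n\<bar> \<longrightarrow> \<infinity>\<close>.\<close>

definition inhom_M :: "real \<Rightarrow> real \<Rightarrow> ereal" where
  "inhom_M \<alpha> \<gamma> =
     Liminf (filtercomap (\<lambda>n::int. \<bar>n\<bar>) at_top)
       (\<lambda>n. ereal (\<bar>of_int n\<bar> * nint_dist (of_int n * \<alpha> - \<gamma>)))"

definition inhom_rho :: "real \<Rightarrow> ereal" where
  "inhom_rho \<alpha> =
     (SUP \<gamma> \<in> {\<gamma>. \<not> (\<exists>k l :: int. \<gamma> = of_int k + \<alpha> * of_int l)}. inhom_M \<alpha> \<gamma>)"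

primrec nicf_rem :: "real \<Rightarrow> nat \<Rightarrow> real" where
  "nicf_rem \<alpha> 0 = \<alpha>"
| "nicf_rem \<alpha> (Suc i) = nint_dist (1 / nicf_rem \<alpha> i)"

fun nicf_a :: "real \<Rightarrow> nat \<Rightarrow> int" where
  "nicf_a \<alpha> 0 = 0"
| "nicf_a \<alpha> (Suc i) =
     (if nint_dist (1 / nicf_rem \<alpha> i) = frac (1 / nicf_rem \<alpha> i)
      then \<lfloor>1 / nicf_rem \<alpha> i\<rfloor> else \<lceil>1 / nicf_rem \<alpha> i\<rceil>)"

text \<open>The signs \<open>\<epsilon>\<^sub>i\<close> are indexed by \<open>i \<ge> 1\<close>; the value at \<open>0\<close> is never used.\<close>

fun nicf_eps :: "real \<Rightarrow> nat \<Rightarrow> int" where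
  "nicf_eps \<alpha> 0 = 1"
| "nicf_eps \<alpha> (Suc 0) = 1"
| "nicf_eps \<alpha> (Suc (Suc i)) =
     (if nint_dist (1 / nicf_rem \<alpha> i) = frac (1 / nicf_rem \<alpha> i) then 1 else - 1)"

text \<open>In the equations for index \<open>1\<close> the values \<open>p\<^sub>-\<^sub>1 = 1\<close> and \<open>q\<^sub>-\<^sub>1 = 0\<close> are inserted.\<close>

fun nicf_p :: "real \<Rightarrow> nat \<Rightarrow> int" where
  "nicf_p \<alpha> 0 = nicf_a \<alpha> 0"
| "nicf_p \<alpha> (Suc 0) = nicf_a \<alpha> 1 * nicf_p \<alpha> 0 + nicf_eps \<alpha> 1 * 1"
| "nicf_p \<alpha> (Suc (Suc i)) =
     nicf_a \<alpha> (Suc (Suc i)) * nicf_p \<alpha> (Suc i) + nicf_eps \<alpha> (Suc (Suc i)) * nicf_p \<alpha> i"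

fun nicf_q :: "real \<Rightarrow> nat \<Rightarrow> int" where
  "nicf_q \<alpha> 0 = 1"
| "nicf_q \<alpha> (Suc 0) = nicf_a \<alpha> 1 * nicf_q \<alpha> 0 + nicf_eps \<alpha> 1 * 0"
| "nicf_q \<alpha> (Suc (Suc i)) =
     nicf_a \<alpha> (Suc (Suc i)) * nicf_q \<alpha> (Suc i) + nicf_eps \<alpha> (Suc (Suc i)) * nicf_q \<alpha> i"

definition nicf_D :: "real \<Rightarrow> nat \<Rightarrow> real" where
  "nicf_D \<alpha> i = \<bar>of_int (nicf_q \<alpha> i) * \<alpha> - of_int (nicf_p \<alpha> i)\<bar>"

text \<open>If \<open>a\<^sub>i\<close> is odd, the cardinality below is the position \<open>j\<close> of \<open>a\<^sub>i\<close> among the odd terms of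
  \<open>a\<^sub>1, a\<^sub>2, \<dots>\<close>.\<close>

definition nicf_lambda :: "real \<Rightarrow> nat \<Rightarrow> int" where
  "nicf_lambda \<alpha> i =
     (if even (nicf_a \<alpha> i) then 0 else (- 1) ^ card {k \<in> {1..i}. odd (nicf_a \<alpha> k)})"

definition gamma_star :: "real \<Rightarrow> real" where
  "gamma_star \<alpha> =
     (\<Sum>i. 1 / 2 * of_int (nicf_a \<alpha> (Suc i) - 1 + nicf_eps \<alpha> (Suc i) + nicf_lambda \<alpha> (Suc i))
           * nicf_D \<alpha> i)"

definition nicf_R :: "real \<Rightarrow> ereal" where
  "nicf_R \<alpha> = liminf (\<lambda>i. ereal (of_int (nicf_a \<alpha> i)))"

definition bound_two :: real where
  "bound_two = 1 / (2 * (sqrt 13 + 10))"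

definition bound_three :: real where
  "bound_three =
     (let \<theta> = (sqrt 13 - 3) / 2
      in 1 / 4 * (2 - sqrt 3) *
         ((1 - 1 / 4 * (1 + \<theta>\<^sup>2 / (1 - \<theta>))) / (1 + 1 / 4 * (\<theta> - (sqrt 3 - 1) / 2))))"

end

theory Submission
  imports Defs "HOL-Real_Asymp.Real_Asymp"
begin

text \<open>Telescoping gives \<open>2 \<gamma>\<^sub>* = 1 + \<alpha> + \<Lambda>\<close> with \<open>\<Lambda> = \<Sum>\<^sub>i \<lambda>\<^sub>i D\<^sub>i\<^sub>-\<^sub>1\<close>, so \<open>M(\<alpha>, \<gamma>\<^sub>*)\<close> is a
  quarter of the lower limit of \<open>\<bar>N\<bar> \<bar>N \<alpha> - P - \<Lambda>\<bar>\<close> over odd \<open>N\<close>, \<open>P\<close>. Re-expressing \<open>(N, P)\<close> in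
  terms of two consecutive convergents and a partial sum of \<open>\<Lambda>\<close> keeps both coordinates odd (this
  is what the parity of \<open>\<lambda>\<^sub>i\<close> is for). The four points with coordinates \<open>\<plusminus>1\<close> lie in the four
  quadrants, one in each, and form a chain of divided cells in the sense of Barnes and
  Swinnerton-Dyer; concavity of the product along the lines joining vertices of consecutive
  cells shows that it suffices to bound the product at these vertices. A vertex value is a
  function of \<open>(\<xi>, \<zeta>)\<close>, which depends on the future digits, and of \<open>(\<beta>, \<eta>)\<close>, which depends on
  the past ones; since the signs of \<open>\<lambda>\<^sub>i\<close> alternate, the two contributions of \<open>\<Lambda>\<close> have opposite
  signs. Both pairs are moved by projective maps, so their ranges are controlled by linear
  inequalities invariant under these maps.\<close>

section \<open>Real inequalities\<close>

lemma min_le_concave_product: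
  fixes a p q v w w1 :: real
  assumes a_pos: "0 < a" and w_between: "v \<le> w" "w \<le> w1"
  shows "min ((v + p) * (q - a * v)) ((w1 + p) * (q - a * w1)) \<le> (w + p) * (q - a * w)"
proof -
  define g where "g x = (x + p) * (q - a * x)" for x
  have left: "g w - g v = (w - v) * (q - a * (v + w + p))"
    and right: "g w1 - g w = (w1 - w) * (q - a * (w + w1 + p))" unfolding g_def by algebra+
  have "min (g v) (g w1) \<le> g w"
  proof (cases "a * (v + w + p) \<le> q")
    case True
    then have "0 \<le> (w - v) * (q - a * (v + w + p))" using w_between by simp
    then show ?thesis using left by simp
  next
    case False
    have "a * (v + w + p) \<le> a * (w + w1 + p)" using a_pos w_between by simp
    then have "(w1 - w) * (q - a * (w + w1 + p)) \<le> 0"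
      using w_between False by (intro mult_nonneg_nonpos) auto
    then show ?thesis using right by simp
  qed
  then show ?thesis by (simp only: g_def)
qed

text \<open>On either side of its zeros the product is monotone; between them it is concave.\<close>

lemma abs_product_ge_of_endpoints:
  fixes a p q v w w1 w2 C :: real
  assumes a_pos: "0 < a" and abs_p_less: "\<bar>p\<bar> < v" and av_less_q: "a * v < q"
    and w1_left: "a * w1 \<le> q" and w2_right: "q \<le> a * w2"
    and endpoint: "\<And>x. x \<in> {- v, v, w1, w2} \<Longrightarrow> C \<le> \<bar>x + p\<bar> * \<bar>q - a * x\<bar>"
    and w_range: "w \<le> - v \<or> v \<le> w \<and> w \<le> w1 \<or> w2 \<le> w"
  shows "C \<le> \<bar>w + p\<bar> * \<bar>q - a * w\<bar>"
proof -
  have av_pos: "0 < a * v" using a_pos abs_p_less by simp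
  consider (left) "w \<le> - v" | (between) "v \<le> w" "w \<le> w1" | (right) "w2 \<le> w" using w_range by blast
  then show ?thesis
  proof cases
    case left
    then have "a * w \<le> a * (- v)" using a_pos by (intro mult_left_mono) auto
    then have "\<bar>- v + p\<bar> * \<bar>q - a * (- v)\<bar> \<le> \<bar>w + p\<bar> * \<bar>q - a * w\<bar>"
      using left abs_p_less av_less_q av_pos by (intro mult_mono) auto
    then show ?thesis using endpoint[of "- v"] by simp
  next
    case between
    have "\<bar>x + p\<bar> * \<bar>q - a * x\<bar> = (x + p) * (q - a * x)" if "v \<le> x" "x \<le> w1" for x
    proof -
      have "a * x \<le> a * w1" using a_pos that(2) by simp
      then show ?thesis using abs_p_less w1_left that(1) by simp
    qed
    then show ?thesis
      using endpoint[of v] endpoint[of w1] min_le_concave_product[OF a_pos between, of p q] between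
      by simp
  next
    case right
    have "a * v < a * w2" using av_less_q w2_right by linarith
    then have "v < w2" using a_pos by simp
    moreover have "a * w2 \<le> a * w" using a_pos right by simp
    ultimately have "\<bar>w2 + p\<bar> * \<bar>q - a * w2\<bar> \<le> \<bar>w + p\<bar> * \<bar>q - a * w\<bar>"
      using right abs_p_less w2_right by (intro mult_mono) auto
    then show ?thesis using endpoint[of w2] by simp
  qed
qed

lemma linear_nonneg_between:
  fixes p q x u :: real
  assumes "0 \<le> x" "x \<le> u" "0 \<le> p" "0 \<le> p + u * q"
  shows "0 \<le> p + x * q"
proof (cases "0 \<le> q")
  case True
  then show ?thesis using assms by simp
next
  case False
  then have "u * q \<le> x * q" using assms by (intro mult_right_mono_neg) auto
  then show ?thesis using assms by linarith
qed

lemma mult_diff_le_mono: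
  fixes T D X i r x :: real
  assumes "T * (D - r) \<le> X * (1 - i * r)" and "T \<le> i * X" and "x \<le> r"
  shows "T * (D - x) \<le> X * (1 - i * x)"
proof -
  have "0 \<le> (r - x) * (i * X - T)" using assms(2,3) by simp
  then show ?thesis using assms(1) by (simp add: algebra_simps)
qed

lemma le_of_diff_eq_divide:
  fixes l r N M :: real
  assumes "r - l = N / M" and "0 \<le> N" and "0 < M"
  shows "l \<le> r"
proof -
  have "0 \<le> N / M" using assms by simp
  then show ?thesis using assms(1) by linarith
qed

lemma nonpos_of_halving_step:
  fixes f :: "nat \<Rightarrow> real"
  assumes bound: "\<And>k. k \<ge> k0 \<Longrightarrow> f k \<le> 1"
    and step: "\<And>k h. k \<ge> k0 \<Longrightarrow> 0 \<le> h \<Longrightarrow> f (Suc k) \<le> h \<Longrightarrow> f k \<le> 1 / 2 * h"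
    and k_ge: "k \<ge> k0"
  shows "f k \<le> 0"
proof -
  have "f j \<le> (1 / 2) ^ m" if "j \<ge> k0" for m j
    using that
  proof (induction m arbitrary: j)
    case 0
    then show ?case using bound by simp
  next
    case (Suc m)
    then show ?case using step[of j "(1 / 2) ^ m"] by simp
  qed
  moreover have "(\<lambda>m. (1 / 2 :: real) ^ m) \<longlonglongrightarrow> 0"
    by (rule LIMSEQ_realpow_zero) auto
  ultimately show ?thesis using k_ge by (intro LIMSEQ_le_const) auto
qed

section \<open>Chains of divided cells\<close>

text \<open>In the application \<open>n k = a\<^sub>k\<^sub>+\<^sub>1\<close>, \<open>\<epsilon> k = \<epsilon>\<^sub>k\<^sub>+\<^sub>1\<close> and \<open>\<xi> k = \<alpha>\<^sub>k\<close>. The pair \<open>(\<xi> k, \<zeta> k)\<close>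
  depends on the digits from level \<open>k\<close> on, \<open>(\<beta> k, \<eta> k)\<close> on those before it.\<close>

locale cell_chain =
  fixes n \<epsilon> :: "nat \<Rightarrow> int" and \<xi> \<zeta> \<beta> \<eta> :: "nat \<Rightarrow> real"
  assumes digit_ge_two: "2 \<le> n k"
    and eps_cases: "\<epsilon> k = 1 \<or> \<epsilon> k = - 1"
    and eps_after_two: "n k = 2 \<Longrightarrow> \<epsilon> (Suc k) = 1"
    and xi_pos: "0 < \<xi> k" and xi_less_half: "\<xi> k < 1 / 2"
    and inverse_xi: "1 / \<xi> k = n k + \<epsilon> (Suc k) * \<xi> (Suc k)"
    and zeta_rec: "\<zeta> k = \<xi> k * (if odd (n k) then 1 - \<zeta> (Suc k) else \<zeta> (Suc k))"
    and zeta_nonneg: "0 \<le> \<zeta> k" and zeta_le_xi: "\<zeta> k \<le> \<xi> k"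
    and beta_0: "\<beta> 0 = 0" and eta_0: "\<eta> 0 = 0"
    and beta_Suc: "\<beta> (Suc k) = \<epsilon> (Suc k) / (n k + \<beta> k)"
    and eta_Suc: "\<eta> (Suc k) = \<epsilon> (Suc k) * (if odd (n k) then 1 + \<eta> k else - \<eta> k) / (n k + \<beta> k)"
begin

definition den :: "nat \<Rightarrow> real" where
  "den k = n k + \<beta> k"

definition past_shift :: "nat \<Rightarrow> real" where
  "past_shift k = (if odd (n k) then 1 + \<eta> k else - \<eta> k)"

lemma digit_odd_ge: "odd (n k) \<Longrightarrow> 3 \<le> n k"
  using digit_ge_two[of k] by (cases "n k = 2") auto

lemma digit_even_ge: "even (n k) \<Longrightarrow> n k \<noteq> 2 \<Longrightarrow> 4 \<le> n k"
  using digit_ge_two[of k] by (cases "n k = 3") auto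

lemma real_eps_cases: "real_of_int (\<epsilon> k) = 1 \<or> real_of_int (\<epsilon> k) = - 1"
  using eps_cases[of k] by auto

lemma abs_past_shift_if: "\<bar>\<beta> k\<bar> + \<bar>\<eta> k\<bar> < 1 \<Longrightarrow> 1 + \<bar>past_shift k\<bar> < den k"
  using digit_ge_two[of k] digit_odd_ge[of k] by (auto simp: past_shift_def den_def)

lemma abs_beta_eta: "\<bar>\<beta> k\<bar> + \<bar>\<eta> k\<bar> < 1"
proof (induction k)
  case 0
  then show ?case by (simp add: beta_0 eta_0)
next
  case (Suc k)
  then have shift: "1 + \<bar>past_shift k\<bar> < den k" by (rule abs_past_shift_if)
  have "\<bar>\<beta> (Suc k)\<bar> + \<bar>\<eta> (Suc k)\<bar> = (1 + \<bar>past_shift k\<bar>) / den k"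
    using shift real_eps_cases[of "Suc k"]
    by (auto simp: beta_Suc eta_Suc den_def past_shift_def abs_mult add_divide_distrib)
  then show ?case using shift by simp
qed

lemma one_add_beta_eta_pos:
  "0 < 1 + \<beta> k + \<eta> k" "0 < 1 + \<beta> k - \<eta> k" "0 < 1 - \<beta> k + \<eta> k" "0 < 1 - \<beta> k - \<eta> k"
  using abs_beta_eta[of k] by linarith+

lemma abs_past_shift: "1 + \<bar>past_shift k\<bar> < den k"
  by (rule abs_past_shift_if) (rule abs_beta_eta)

lemma beta_bounds: "- 1 < \<beta> k" "\<beta> k < 1"
  using abs_beta_eta[of k] by linarith+

lemma den_gt_one: "1 < den k"
  using abs_past_shift[of k] by linarith

lemma den_beta: "den k * \<beta> (Suc k) = \<epsilon> (Suc k)"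
  using den_gt_one[of k] by (simp add: beta_Suc den_def)

lemma den_eta: "den k * \<eta> (Suc k) = \<epsilon> (Suc k) * past_shift k"
  using den_gt_one[of k] by (simp add: eta_Suc den_def past_shift_def)

lemma one_add_xi_beta_bounds: "0 < 1 + \<xi> k * \<beta> k" "1 + \<xi> k * \<beta> k \<le> 3 / 2"
proof -
  have "\<bar>\<xi> k * \<beta> k\<bar> \<le> 1 / 2 * 1"
    unfolding abs_mult
    using xi_pos[of k] xi_less_half[of k] beta_bounds[of k] by (intro mult_mono) auto
  then show "0 < 1 + \<xi> k * \<beta> k" "1 + \<xi> k * \<beta> k \<le> 3 / 2" by linarith+
qed

lemma xi_mult_inverse: "\<xi> k * (n k + \<epsilon> (Suc k) * \<xi> (Suc k)) = 1"
  using inverse_xi[of k] xi_pos[of k] by (simp add: field_simps)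

text \<open>A point of the lattice coset has odd integral coordinates \<open>(w, v)\<close> at every level. The two
  forms are, up to factors depending only on \<open>k\<close>, its two real coordinates.\<close>

definition past_form :: "nat \<Rightarrow> int \<Rightarrow> int \<Rightarrow> real" where
  "past_form k w v = w + v * \<beta> k + \<eta> k"

definition future_form :: "nat \<Rightarrow> int \<Rightarrow> int \<Rightarrow> real" where
  "future_form k w v = v - \<xi> k * w + \<zeta> k"

definition cell_value :: "nat \<Rightarrow> int \<Rightarrow> int \<Rightarrow> real" where
  "cell_value k w v = \<bar>past_form k w v\<bar> * \<bar>future_form k w v\<bar> / (1 + \<xi> k * \<beta> k)"

definition next_w :: "nat \<Rightarrow> int \<Rightarrow> int" where
  "next_w k v = (if odd (n k) then \<epsilon> (Suc k) * v else - \<epsilon> (Suc k) * v)"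

definition next_v :: "nat \<Rightarrow> int \<Rightarrow> int \<Rightarrow> int" where
  "next_v k w v = (if odd (n k) then w - n k * v - 1 else n k * v - w)"

lemma den_past_form: "den k * past_form (Suc k) w v = den k * w + \<epsilon> (Suc k) * (v + past_shift k)"
proof -
  have "den k * past_form (Suc k) w v = den k * w + v * (den k * \<beta> (Suc k)) + den k * \<eta> (Suc k)"
    by (simp add: past_form_def algebra_simps)
  then show ?thesis unfolding den_beta den_eta by (simp add: algebra_simps)
qed

lemma past_form_next: "den k * \<bar>past_form (Suc k) (next_w k v) (next_v k w v)\<bar> = \<bar>past_form k w v\<bar>"
proof -
  have "\<bar>den k * past_form (Suc k) (next_w k v) (next_v k w v)\<bar> = \<bar>past_form k w v\<bar>"
    unfolding den_past_form using real_eps_cases[of "Suc k"]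
    by (auto simp: past_form_def next_w_def next_v_def past_shift_def den_def algebra_simps)
  then show ?thesis using den_gt_one[of k] by (simp add: abs_mult)
qed

lemma future_form_next:
  "\<xi> k * future_form (Suc k) (next_w k v) (next_v k w v)
    = (if odd (n k) then - 1 else 1) * future_form k w v"
proof -
  have "\<xi> k * future_form (Suc k) (next_w k v) (next_v k w v) = (if odd (n k) then - 1 else 1) *
      (v * (\<xi> k * (n k + \<epsilon> (Suc k) * \<xi> (Suc k))) - \<xi> k * w + \<zeta> k)"
    by (simp add: future_form_def next_w_def next_v_def zeta_rec[of k] algebra_simps)
  then show ?thesis unfolding xi_mult_inverse by (simp add: future_form_def)
qed

lemma abs_future_form_next:
  "\<xi> k * \<bar>future_form (Suc k) (next_w k v) (next_v k w v)\<bar> = \<bar>future_form k w v\<bar>"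
  using arg_cong[OF future_form_next[of k v w], of abs] xi_pos[of k]
  by (simp add: abs_mult split: if_splits)

lemma one_add_xi_beta_next: "1 + \<xi> k * \<beta> k = \<xi> k * den k * (1 + \<xi> (Suc k) * \<beta> (Suc k))"
proof -
  have "\<xi> k * den k * (1 + \<xi> (Suc k) * \<beta> (Suc k)) = \<xi> k * (den k + \<xi> (Suc k) * (den k * \<beta> (Suc k)))"
    by (simp add: algebra_simps)
  also have "\<dots> = \<xi> k * (n k + \<epsilon> (Suc k) * \<xi> (Suc k)) + \<xi> k * \<beta> k"
    unfolding den_beta by (simp add: den_def algebra_simps)
  finally show ?thesis by (simp only: xi_mult_inverse)
qed

lemma cell_value_next: "cell_value (Suc k) (next_w k v) (next_v k w v) = cell_value k w v"
  unfolding cell_value_def past_form_next[of k v w, symmetric]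
    abs_future_form_next[of k v w, symmetric] one_add_xi_beta_next[of k]
  using xi_pos[of k] den_gt_one[of k] by simp

lemma odd_next: "odd w \<Longrightarrow> odd v \<Longrightarrow> odd (next_w k v) \<and> odd (next_v k w v)"
  using eps_cases[of "Suc k"] by (auto simp: next_w_def next_v_def)

lemma abs_next_w: "\<bar>next_w k v\<bar> = \<bar>v\<bar>"
  using eps_cases[of "Suc k"] by (auto simp: next_w_def abs_mult)

definition vertices_ge :: "real \<Rightarrow> nat \<Rightarrow> bool" where
  "vertices_ge T k \<longleftrightarrow> (\<forall>w\<in>{1, - 1}. \<forall>v\<in>{1, - 1}. T \<le> cell_value k w v)"

lemma cell_value_vertex:
  "cell_value k 1 1 = (1 + \<beta> k + \<eta> k) * (1 - \<xi> k + \<zeta> k) / (1 + \<xi> k * \<beta> k)"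
  "cell_value k (- 1) (- 1) = (1 + \<beta> k - \<eta> k) * (1 - \<xi> k - \<zeta> k) / (1 + \<xi> k * \<beta> k)"
  "cell_value k 1 (- 1) = (1 - \<beta> k + \<eta> k) * (1 + \<xi> k - \<zeta> k) / (1 + \<xi> k * \<beta> k)"
  "cell_value k (- 1) 1 = (1 - \<beta> k - \<eta> k) * (1 + \<xi> k + \<zeta> k) / (1 + \<xi> k * \<beta> k)"
proof -
  have "0 < 1 - \<xi> k - \<zeta> k" using xi_less_half[of k] zeta_le_xi[of k] by linarith
  then show
    "cell_value k 1 1 = (1 + \<beta> k + \<eta> k) * (1 - \<xi> k + \<zeta> k) / (1 + \<xi> k * \<beta> k)"
    "cell_value k (- 1) (- 1) = (1 + \<beta> k - \<eta> k) * (1 - \<xi> k - \<zeta> k) / (1 + \<xi> k * \<beta> k)"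
    "cell_value k 1 (- 1) = (1 - \<beta> k + \<eta> k) * (1 + \<xi> k - \<zeta> k) / (1 + \<xi> k * \<beta> k)"
    "cell_value k (- 1) 1 = (1 - \<beta> k - \<eta> k) * (1 + \<xi> k + \<zeta> k) / (1 + \<xi> k * \<beta> k)"
    using xi_pos[of k] zeta_nonneg[of k] zeta_le_xi[of k] one_add_beta_eta_pos[of k]
    by (simp_all add: cell_value_def past_form_def future_form_def abs_if)
qed

lemma cell_value_corner_ge:
  assumes "vertices_ge T k" and v_nonzero: "v \<noteq> 0" and abs_eq: "\<bar>w\<bar> = \<bar>v\<bar>"
  shows "T \<le> cell_value k w v"
proof -
  have "cell_value k (sgn w) (sgn v) \<le> cell_value k w v"
    unfolding cell_value_def
  proof (intro divide_right_mono mult_mono)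
    define m :: real where "m = \<bar>v\<bar> - 1"
    have m_nonneg: "0 \<le> m" using v_nonzero by (simp add: m_def)
    have m_beta: "- m \<le> m * \<beta> k" "m * \<beta> k \<le> m"
      using m_nonneg beta_bounds[of k] mult_left_mono[of "- 1" "\<beta> k" m] mult_left_mono[of "\<beta> k" 1 m]
      by auto
    have m_xi: "0 \<le> m * \<xi> k" "m * \<xi> k \<le> m"
      using m_nonneg xi_pos[of k] xi_less_half[of k] mult_left_mono[of "\<xi> k" 1 m] by auto
    have coords: "real_of_int w = (1 + m) * sgn w" "real_of_int v = (1 + m) * sgn v"
      using v_nonzero abs_eq by (auto simp: m_def sgn_if)
    have signs: "sgn w = 1 \<or> sgn w = - 1" "sgn v = 1 \<or> sgn v = - 1"
      using v_nonzero abs_eq by (auto simp: sgn_if)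
    show "\<bar>past_form k (sgn w) (sgn v)\<bar> \<le> \<bar>past_form k w v\<bar>"
      unfolding past_form_def coords using signs m_nonneg m_beta one_add_beta_eta_pos[of k]
      by (auto simp: algebra_simps abs_if)
    show "\<bar>future_form k (sgn w) (sgn v)\<bar> \<le> \<bar>future_form k w v\<bar>"
      unfolding future_form_def coords
      using signs m_nonneg m_xi xi_pos[of k] xi_less_half[of k] zeta_nonneg[of k] zeta_le_xi[of k]
      by (auto simp: algebra_simps abs_if)
  qed (use one_add_xi_beta_bounds(1)[of k] in auto)
  moreover have "sgn w \<in> {1, - 1}" "sgn v \<in> {1, - 1}" using v_nonzero abs_eq by (auto simp: sgn_if)
  ultimately show ?thesis using assms(1) unfolding vertices_ge_def by force
qed

lemma sgn_future_form:
  assumes v_nonzero: "v \<noteq> 0" and abs_le: "\<bar>w\<bar> \<le> \<bar>v\<bar>"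
  shows "0 < real_of_int (sgn v) * future_form k w v"
proof -
  have "\<xi> k * \<bar>w\<bar> \<le> \<xi> k * \<bar>v\<bar>" using abs_le xi_pos[of k] by (intro mult_left_mono) auto
  moreover have "\<xi> k * \<bar>v\<bar> \<le> 1 / 2 * \<bar>v\<bar>"
    using xi_less_half[of k] by (intro mult_right_mono) auto
  moreover have "1 \<le> real_of_int \<bar>v\<bar>" using v_nonzero by linarith
  moreover have "real_of_int (sgn v) * future_form k w v
    = \<bar>v\<bar> - real_of_int (sgn v) * (\<xi> k * w) + real_of_int (sgn v) * \<zeta> k"
    by (simp add: future_form_def algebra_simps sgn_if)
  moreover have "real_of_int (sgn v) * (\<xi> k * w) \<le> \<xi> k * \<bar>w\<bar>"
    using xi_pos[of k] by (auto simp: sgn_if)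
  moreover have "- \<zeta> k \<le> real_of_int (sgn v) * \<zeta> k" using zeta_nonneg[of k] by (auto simp: sgn_if)
  ultimately show ?thesis using zeta_le_xi[of k] xi_less_half[of k] by linarith
qed

lemma cell_value_ge_of_endpoints:
  assumes v_nonzero: "v \<noteq> 0" and w1_left: "0 \<le> real_of_int (sgn v) * future_form k w1 v"
    and w2_right: "real_of_int (sgn v) * future_form k w2 v \<le> 0"
    and endpoint: "\<And>x. x \<in> {v, - v, w1, w2} \<Longrightarrow> T \<le> cell_value k x v"
    and w_range: "sgn v * w \<le> - \<bar>v\<bar> \<or> \<bar>v\<bar> \<le> sgn v * w \<and> sgn v * w \<le> sgn v * w1
      \<or> sgn v * w2 \<le> sgn v * w"
  shows "T \<le> cell_value k w v"
proof -
  define s :: real where "s = real_of_int (sgn v)"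
  define p where "p = s * (v * \<beta> k + \<eta> k)"
  define q where "q = s * (v + \<zeta> k)"
  define N where "N = 1 + \<xi> k * \<beta> k"
  have s_cases: "s = 1 \<or> s = - 1" and s_mult_v: "s * v = \<bar>real_of_int v\<bar>"
    using v_nonzero by (auto simp: s_def sgn_if)
  have forms: "\<bar>s * x + p\<bar> = \<bar>past_form k x v\<bar>" "\<bar>q - \<xi> k * (s * x)\<bar> = \<bar>future_form k x v\<bar>"
      "q - \<xi> k * (s * x) = s * future_form k x v" for x
    using s_cases by (auto simp: p_def q_def past_form_def future_form_def algebra_simps abs_if)
  have "T * N \<le> \<bar>s * w + p\<bar> * \<bar>q - \<xi> k * (s * w)\<bar>"
  proof (rule abs_product_ge_of_endpoints[OF xi_pos, where v = "\<bar>real_of_int v\<bar>"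
        and ?w1.0 = "s * w1" and ?w2.0 = "s * w2"])
    have "1 * \<bar>\<eta> k\<bar> \<le> \<bar>v\<bar> * \<bar>\<eta> k\<bar>" using v_nonzero by (intro mult_right_mono) linarith+
    then have "\<bar>v * \<beta> k + \<eta> k\<bar> \<le> \<bar>v\<bar> * (\<bar>\<beta> k\<bar> + \<bar>\<eta> k\<bar>)"
      using abs_triangle_ineq[of "v * \<beta> k" "\<eta> k"] by (simp add: abs_mult distrib_left)
    also have "\<dots> < \<bar>real_of_int v\<bar> * 1"
      unfolding of_int_abs using v_nonzero abs_beta_eta[of k] by (intro mult_strict_left_mono) auto
    finally show "\<bar>p\<bar> < \<bar>real_of_int v\<bar>" using s_cases by (auto simp: p_def abs_mult)
    show "\<xi> k * \<bar>real_of_int v\<bar> < q"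
      using sgn_future_form[OF v_nonzero order_refl, of k] forms(3)[of v] s_mult_v
      by (simp add: s_def[symmetric])
    show "\<xi> k * (s * w1) \<le> q" using w1_left forms(3)[of w1] by (simp add: s_def)
    show "q \<le> \<xi> k * (s * w2)" using w2_right forms(3)[of w2] by (simp add: s_def)
    have "s * x = real_of_int (sgn v * x)" for x :: int by (simp add: s_def)
    then show "s * w \<le> - \<bar>real_of_int v\<bar> \<or> \<bar>real_of_int v\<bar> \<le> s * w \<and> s * w \<le> s * w1
      \<or> s * w2 \<le> s * w"
      using w_range by (simp only: of_int_abs[symmetric] of_int_minus[symmetric] of_int_le_iff)
    fix x :: real assume "x \<in> {- \<bar>real_of_int v\<bar>, \<bar>real_of_int v\<bar>, s * w1, s * w2}"
    then obtain x' where "x = s * x'" "x' \<in> {v, - v, w1, w2}"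
      using s_mult_v by (metis insert_iff mult_minus_right of_int_minus singletonD)
    then show "T * N \<le> \<bar>x + p\<bar> * \<bar>q - \<xi> k * x\<bar>"
      using endpoint[of x'] one_add_xi_beta_bounds(1)[of k] unfolding N_def cell_value_def
      by (simp add: forms(1,2) pos_le_divide_eq)
  qed
  then show ?thesis
    unfolding forms(1,2) cell_value_def N_def using one_add_xi_beta_bounds(1)[of k]
    by (simp add: pos_le_divide_eq)
qed

text \<open>The points with \<open>\<bar>w\<bar> = \<bar>v\<bar>\<close> are multiples of vertices at level \<open>k\<close>, those with
  \<open>\<bar>next_v k w v\<bar> = \<bar>v\<bar>\<close> multiples of vertices at level \<open>k + 1\<close>.\<close>

lemma cell_value_ge_of_local_min:
  assumes vertices_k: "vertices_ge T k" and vertices_Suc: "vertices_ge T (Suc k)"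
    and v_nonzero: "v \<noteq> 0" and abs_v_le_w: "\<bar>v\<bar> \<le> \<bar>w\<bar>" and abs_v_le_next: "\<bar>v\<bar> \<le> \<bar>next_v k w v\<bar>"
  shows "T \<le> cell_value k w v"
proof -
  define w1 where "w1 = n k * v + (if odd (n k) then 1 else 0) - v"
  define w2 where "w2 = n k * v + (if odd (n k) then 1 else 0) + v"
  have next_eq: "next_v k w1 v = (if odd (n k) then - v else v)"
    "next_v k w2 v = (if odd (n k) then v else - v)"
    by (auto simp: next_v_def w1_def w2_def)
  have sgn_next:
    "0 < real_of_int (sgn (next_v k x v)) * (if odd (n k) then - 1 else 1) * future_form k x v"
    if "\<bar>next_v k x v\<bar> = \<bar>v\<bar>" for x
  proof -
    have "0 < real_of_int (sgn (next_v k x v))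
      * (\<xi> k * future_form (Suc k) (next_w k v) (next_v k x v))"
      using sgn_future_form[of "next_v k x v" "next_w k v" "Suc k"] that v_nonzero xi_pos[of k]
      by (simp add: abs_next_w mult.left_commute)
    then show ?thesis unfolding future_form_next by (simp only: mult.assoc)
  qed
  show ?thesis
  proof (rule cell_value_ge_of_endpoints[OF v_nonzero])
    show "0 \<le> real_of_int (sgn v) * future_form k w1 v"
      using sgn_next[of w1] next_eq(1) by (simp split: if_splits)
    show "real_of_int (sgn v) * future_form k w2 v \<le> 0"
      using sgn_next[of w2] next_eq(2) by (simp split: if_splits)
    show "sgn v * w \<le> - \<bar>v\<bar> \<or> \<bar>v\<bar> \<le> sgn v * w \<and> sgn v * w \<le> sgn v * w1 \<or> sgn v * w2 \<le> sgn v * w"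
      using v_nonzero abs_v_le_w abs_v_le_next
      by (auto simp: next_v_def w1_def w2_def abs_if sgn_if split: if_splits)
  next
    fix x assume x_endpoint: "x \<in> {v, - v, w1, w2}"
    show "T \<le> cell_value k x v"
    proof (cases "x \<in> {v, - v}")
      case True
      then show ?thesis using cell_value_corner_ge[OF vertices_k v_nonzero, of x] by auto
    next
      case False
      then have "\<bar>next_v k x v\<bar> = \<bar>v\<bar>" using x_endpoint next_eq by auto
      then show ?thesis
        using cell_value_corner_ge[OF vertices_Suc, of "next_v k x v" "next_w k v"] v_nonzero
        by (auto simp: abs_next_w cell_value_next)
    qed
  qed
qed

lemma cell_value_ge_of_abs_le:
  assumes "\<And>k. k \<ge> K \<Longrightarrow> vertices_ge T k"
    and "k \<ge> K" "odd w" "odd v" "\<bar>v\<bar> \<le> \<bar>w\<bar>"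
  shows "T \<le> cell_value k w v"
  using assms(2-)
proof (induction "nat \<bar>v\<bar>" arbitrary: k w v rule: less_induct)
  case less
  have v_nonzero: "v \<noteq> 0" using less.prems by auto
  show ?case
  proof (cases "\<bar>v\<bar> \<le> \<bar>next_v k w v\<bar>")
    case True
    then show ?thesis
      using cell_value_ge_of_local_min[OF assms(1) assms(1) v_nonzero] less.prems by simp
  next
    case False
    then have "nat \<bar>next_v k w v\<bar> < nat \<bar>v\<bar>" and "\<bar>next_v k w v\<bar> \<le> \<bar>next_w k v\<bar>"
      using v_nonzero by (auto simp: abs_next_w)
    then show ?thesis
      using less.hyps[of "next_v k w v" "Suc k" "next_w k v"] odd_next less.prems
      by (simp add: cell_value_next)
  qed
qed

lemma cell_value_ge_of_future_form_small:
  assumes vertices: "\<And>k. k \<ge> K \<Longrightarrow> vertices_ge T k" and "j \<le> K"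
  shows "\<exists>c>0. \<forall>w v. odd w \<longrightarrow> odd v \<longrightarrow> \<bar>future_form j w v\<bar> < c \<longrightarrow> T \<le> cell_value j w v"
  using \<open>j \<le> K\<close>
proof (induction rule: inc_induct)
  case base
  have "T \<le> cell_value K w v" if "odd w" "odd v" "\<bar>future_form K w v\<bar> < 1" for w v
  proof -
    have "\<bar>\<xi> K * w\<bar> \<le> 1 / 2 * \<bar>w\<bar>"
      unfolding abs_mult using xi_pos[of K] xi_less_half[of K] by (intro mult_mono) auto
    moreover have "1 \<le> \<bar>w\<bar>" using that(1) by (cases "w = 0") auto
    ultimately have "real_of_int \<bar>v\<bar> < \<bar>w\<bar> + 1"
      using that(3) zeta_nonneg[of K] zeta_le_xi[of K] xi_less_half[of K]
      unfolding future_form_def by linarith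
    then have "\<bar>v\<bar> \<le> \<bar>w\<bar>" by linarith
    then show ?thesis using cell_value_ge_of_abs_le[OF vertices order_refl] that by blast
  qed
  then show ?case by (intro exI[of _ 1]) auto
next
  case (step j)
  then obtain c where c_pos: "0 < c"
    and value_ge: "\<And>w v. odd w \<Longrightarrow> odd v \<Longrightarrow> \<bar>future_form (Suc j) w v\<bar> < c
      \<Longrightarrow> T \<le> cell_value (Suc j) w v"
    by blast
  have "T \<le> cell_value j w v" if "odd w" "odd v" "\<bar>future_form j w v\<bar> < \<xi> j * c" for w v
  proof -
    have "\<xi> j * \<bar>future_form (Suc j) (next_w j v) (next_v j w v)\<bar> < \<xi> j * c"
      using that(3) by (simp only: abs_future_form_next)
    then have "\<bar>future_form (Suc j) (next_w j v) (next_v j w v)\<bar> < c" using xi_pos[of j] by simp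
    then show ?thesis
      using value_ge odd_next[OF that(1,2)] unfolding cell_value_next[of j v w, symmetric] by blast
  qed
  then show ?case using c_pos xi_pos[of j] by (intro exI[of _ "\<xi> j * c"]) auto
qed

theorem product_ge_of_vertices_ge:
  assumes "\<And>k. k \<ge> K \<Longrightarrow> vertices_ge T k"
  shows "\<exists>c>0. \<forall>w v. odd w \<longrightarrow> odd v \<longrightarrow> \<bar>v - \<xi> 0 * w + \<zeta> 0\<bar> < c \<longrightarrow> T \<le> \<bar>w\<bar> * \<bar>v - \<xi> 0 * w + \<zeta> 0\<bar>"
  using cell_value_ge_of_future_form_small[OF assms, of K 0]
  by (simp add: cell_value_def past_form_def future_form_def beta_0 eta_0)

lemma step_cases:
  obtains (odd_pos) "odd (n k)" "\<epsilon> (Suc k) = 1" "past_shift k = 1 + \<eta> k" "3 + \<beta> k \<le> den k"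
    | (odd_neg) "odd (n k)" "\<epsilon> (Suc k) = - 1" "past_shift k = 1 + \<eta> k" "3 + \<beta> k \<le> den k"
    | (even_pos) "even (n k)" "\<epsilon> (Suc k) = 1" "past_shift k = - \<eta> k" "2 + \<beta> k \<le> den k"
    | (even_neg) "even (n k)" "\<epsilon> (Suc k) = - 1" "past_shift k = - \<eta> k" "4 + \<beta> k \<le> den k"
proof (cases "odd (n k)")
  case True
  then have "past_shift k = 1 + \<eta> k" "3 + \<beta> k \<le> den k"
    using digit_odd_ge[OF True] by (simp_all add: past_shift_def den_def)
  then show ?thesis using odd_pos odd_neg True eps_cases[of "Suc k"] by blast
next
  case False
  then have shift: "past_shift k = - \<eta> k" by (simp add: past_shift_def)
  show ?thesis
  proof (cases "\<epsilon> (Suc k) = 1")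
    case True
    then show ?thesis using even_pos False shift digit_ge_two[of k] by (simp add: den_def)
  next
    case neg: False
    then have "4 \<le> n k" using digit_even_ge[of k] eps_after_two[of k] False by blast
    then show ?thesis
      using even_neg False shift neg eps_cases[of "Suc k"] by (simp add: den_def)
  qed
qed

lemma beta_Suc_eq: "\<beta> (Suc k) = \<epsilon> (Suc k) / den k"
  by (simp add: beta_Suc den_def)

lemma beta_Suc_pos_iff: "0 < \<beta> (Suc k) \<longleftrightarrow> \<epsilon> (Suc k) = 1"
  using den_gt_one[of k] eps_cases[of "Suc k"] by (auto simp: beta_Suc_eq)

lemma eta_Suc_iff:
  fixes c d :: real
  shows eta_Suc_le_iff: "\<eta> (Suc k) \<le> c + d * \<beta> (Suc k) \<longleftrightarrow>
      \<epsilon> (Suc k) * past_shift k \<le> c * den k + d * \<epsilon> (Suc k)"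
    and eta_Suc_ge_iff: "c + d * \<beta> (Suc k) \<le> \<eta> (Suc k) \<longleftrightarrow>
      c * den k + d * \<epsilon> (Suc k) \<le> \<epsilon> (Suc k) * past_shift k"
proof -
  have line: "den k * (c + d * \<beta> (Suc k)) = c * den k + d * \<epsilon> (Suc k)"
    unfolding den_beta[symmetric] by (simp add: algebra_simps)
  show "\<eta> (Suc k) \<le> c + d * \<beta> (Suc k) \<longleftrightarrow> \<epsilon> (Suc k) * past_shift k \<le> c * den k + d * \<epsilon> (Suc k)"
    and "c + d * \<beta> (Suc k) \<le> \<eta> (Suc k) \<longleftrightarrow> c * den k + d * \<epsilon> (Suc k) \<le> \<epsilon> (Suc k) * past_shift k"
    unfolding line[symmetric] den_eta[symmetric] using den_gt_one[of k] by simp_all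
qed

end

section \<open>Vertices for small partial quotients\<close>

definition theta :: real where "theta = (sqrt 13 - 3) / 2"

lemma theta_mult_self: "theta * theta = 1 - 3 * theta"
  by (simp add: theta_def field_simps)

lemma theta_bounds: "0 < theta" "3 * theta < 1"
proof -
  have "3 < sqrt 13" by (rule real_less_rsqrt) simp
  then show "0 < theta" by (simp add: theta_def)
  then show "3 * theta < 1" using theta_mult_self mult_pos_pos[of theta theta] by linarith
qed

text \<open>The lower end of the past term \<open>1 + \<beta> - \<eta>\<close> is governed by the digits \<open>\<dots>, 3, 3, 3, 4\<close> with
  signs \<open>\<dots>, 1, 1, -1\<close>; the constant is the value of \<open>(1 + \<beta> - \<eta>) / (3 - c + \<beta>)\<close> for these
  digits.\<close>

definition past_factor :: "real \<Rightarrow> real" where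
  "past_factor c = 2 / 3 * (4 + theta) / ((3 - c) * (4 + theta) - 1)"

lemma past_factor_bounds:
  assumes "0 < c" "c \<le> 1 / 2"
  shows "0 < past_factor c" "past_factor c \<le> 3 / 10"
    and "past_factor c * (3 - c) = 2 / 3 + past_factor c / (4 + theta)"
proof -
  define f where "f = 4 + theta"
  define q where "q = (3 - c) * f"
  have f_ge: "4 \<le> f" using theta_bounds by (simp add: f_def)
  have q_ge: "5 / 2 * f \<le> q" unfolding q_def using assms f_ge by (intro mult_right_mono) auto
  have factor_eq: "past_factor c = 2 / 3 * f / (q - 1)" by (simp add: past_factor_def f_def q_def)
  show "0 < past_factor c" "past_factor c \<le> 3 / 10"
    unfolding factor_eq using f_ge q_ge by (simp_all add: field_simps)
  have "past_factor c * (q - 1) = 2 / 3 * f"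
    unfolding factor_eq using f_ge q_ge by (subst times_divide_eq_left, subst nonzero_mult_div_cancel_right) auto
  then show "past_factor c * (3 - c) = 2 / 3 + past_factor c / (4 + theta)"
    unfolding f_def[symmetric] q_def using f_ge by (simp add: field_simps)
qed

lemma past_slope_bounds:
  assumes c_bounds: "0 < c" "c \<le> 1 / 2"
  defines "r \<equiv> 1 - past_factor c * (3 - c)"
  shows "1 / 4 \<le> r" "r \<le> 1 / 3" "4 * r + r * theta = (4 + theta) / 3 - past_factor c"
proof -
  note factor_bounds = past_factor_bounds[OF c_bounds]
  have r_eq: "r = 1 / 3 - past_factor c / (4 + theta)" using factor_bounds(3) by (simp add: r_def)
  have "past_factor c / (4 + theta) \<le> past_factor c / 4"
    using factor_bounds theta_bounds by (intro divide_left_mono) auto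
  moreover have "0 < past_factor c / (4 + theta)" using factor_bounds theta_bounds by simp
  ultimately show "1 / 4 \<le> r" "r \<le> 1 / 3" unfolding r_eq using factor_bounds(2) by linarith+
  have "r * (4 + theta) = (4 + theta) / 3 - past_factor c"
    unfolding r_eq using theta_bounds by (simp add: field_simps)
  then show "4 * r + r * theta = (4 + theta) / 3 - past_factor c" by (simp add: algebra_simps)
qed

definition theta_line :: "real \<Rightarrow> real \<Rightarrow> real" where
  "theta_line s x = (1 + theta) / 3 + s * (x - theta)"

text \<open>All the lines pass through \<open>(\<theta>, (1 + \<theta>) / 3)\<close>, the fixed point of the step with digit \<open>3\<close> and
  sign \<open>1\<close>. That step pulls the line of slope \<open>s\<close> back to the one of slope \<open>(1 + \<theta>) / 3 - s * \<theta>\<close>.\<close>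

lemma pullback_slope:
  assumes "s \<in> {1 / 4..(4 + theta) / 12}"
  shows "(1 + theta) / 3 - s * theta \<in> {1 / 4..(4 + theta) / 12}"
proof -
  have "s * theta \<le> (4 + theta) / 12 * theta" "1 / 4 * theta \<le> s * theta"
    using assms theta_bounds by (auto intro: mult_right_mono)
  moreover have "(4 + theta) / 12 * theta = (1 + theta) / 12"
    using theta_mult_self by (simp add: distrib_right)
  ultimately have "1 / 4 \<le> (1 + theta) / 3 - s * theta"
    "(1 + theta) / 3 - s * theta \<le> (4 + theta) / 12"
    using theta_bounds by argo+
  then show ?thesis by simp
qed

lemma theta_line_third: "theta_line (1 / 3) x = (1 + x) / 3"
  by (simp add: theta_line_def field_simps)

context cell_chain
begin

lemma eta_Suc_le_theta_line:
  assumes lower: "- 1 / 2 \<le> \<eta> k"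
    and line: "\<And>s. s \<in> {1 / 4..(4 + theta) / 12} \<Longrightarrow> \<eta> k \<le> theta_line s (\<beta> k)"
    and slope: "s \<in> {1 / 4..(4 + theta) / 12}"
  shows "\<eta> (Suc k) \<le> theta_line s (\<beta> (Suc k))"
proof -
  define \<sigma> where "\<sigma> = (1 + theta) / 3 - s * theta"
  have slope_\<sigma>: "1 / 4 \<le> \<sigma>" "\<sigma> \<le> (4 + theta) / 12"
    using pullback_slope[OF slope] by (simp_all add: \<sigma>_def)
  have "\<sigma> * 3 + \<sigma> * theta = (3 + 4 * theta + theta * theta) / 3 - s * (3 * theta + theta * theta)"
    by (simp add: \<sigma>_def field_simps)
  then have fixed_point: "\<sigma> * 3 + \<sigma> * theta = (4 + theta) / 3 - s" unfolding theta_mult_self by simp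
  have line_\<sigma>: "\<eta> k \<le> (1 + theta) / 3 + (\<sigma> * \<beta> k - \<sigma> * theta)"
    using line[of \<sigma>] slope_\<sigma> by (simp add: theta_line_def right_diff_distrib)
  have den_ge: "x * \<sigma> + \<sigma> * \<beta> k \<le> \<sigma> * den k" if "x + \<beta> k \<le> den k" for x
    using mult_left_mono[OF that, of \<sigma>] slope_\<sigma> by (simp add: distrib_left mult.commute)
  have "1 * \<sigma> \<le> \<sigma> * den k" using slope_\<sigma> den_gt_one[of k] by simp
  note bounds = this lower slope[unfolded atLeastAtMost_iff] slope_\<sigma> theta_bounds beta_bounds[of k]
  have "\<epsilon> (Suc k) * past_shift k \<le> \<sigma> * den k + s * \<epsilon> (Suc k)"
  proof (cases rule: step_cases[of k])
    case odd_pos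
    have "1 + \<eta> k \<le> \<sigma> * den k + s" using den_ge[OF odd_pos(4)] line_\<sigma> fixed_point by argo
    then show ?thesis using odd_pos by simp
  next
    case odd_neg
    have "2 * \<sigma> \<le> \<sigma> * den k" using odd_neg bounds by simp
    then have "- (1 + \<eta> k) \<le> \<sigma> * den k - s" using bounds by argo
    then show ?thesis using odd_neg by simp
  next
    case even_pos
    have "- \<eta> k \<le> \<sigma> * den k + s" using bounds by argo
    then show ?thesis using even_pos by simp
  next
    case even_neg
    have "\<eta> k \<le> \<sigma> * den k - s" using den_ge[OF even_neg(4)] line_\<sigma> fixed_point bounds by argo
    then show ?thesis using even_neg by simp
  qed
  then have "\<eta> (Suc k) \<le> \<sigma> + s * \<beta> (Suc k)" unfolding eta_Suc_le_iff .
  then show ?thesis by (simp add: \<sigma>_def theta_line_def algebra_simps)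
qed

lemma eta_bounds_conj:
  "- 1 / 2 \<le> \<eta> k \<and> (\<forall>s\<in>{1 / 4..(4 + theta) / 12}. \<eta> k \<le> theta_line s (\<beta> k))"
proof (induction k)
  case 0
  have "s * theta \<le> (1 + theta) / 3" if "s \<le> (4 + theta) / 12" for s
  proof -
    have "s * theta \<le> 1 / 2 * theta" using that theta_bounds by (intro mult_right_mono) auto
    then show ?thesis using theta_bounds by argo
  qed
  then show ?case by (simp add: beta_0 eta_0 theta_line_def)
next
  case (Suc k)
  then have "\<eta> k \<le> (1 + \<beta> k) / 3" using theta_bounds by (auto simp: theta_line_third[symmetric])
  then have "- 1 / 2 * den k + 0 * \<epsilon> (Suc k) \<le> \<epsilon> (Suc k) * past_shift k"
    using Suc beta_bounds[of k] den_gt_one[of k] by (cases rule: step_cases[of k]) simp_all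
  then have "- 1 / 2 \<le> \<eta> (Suc k)" using eta_Suc_ge_iff[of "- 1 / 2" 0 k] by simp
  then show ?case using eta_Suc_le_theta_line Suc by blast
qed

lemma eta_ge: "- 1 / 2 \<le> \<eta> k"
  using eta_bounds_conj by blast

lemma eta_le_theta_line: "s \<in> {1 / 4..(4 + theta) / 12} \<Longrightarrow> \<eta> k \<le> theta_line s (\<beta> k)"
  using eta_bounds_conj by blast

lemma eta_le_third: "\<eta> k \<le> (1 + \<beta> k) / 3"
  using eta_le_theta_line[of "1 / 3" k] theta_bounds by (simp add: theta_line_third)

lemma past_factor_mult_le:
  assumes c_bounds: "0 < c" "c \<le> 1 / 2"
  shows "past_factor c * (3 - c + \<beta> (Suc k)) \<le> 1 + \<beta> (Suc k) - \<eta> (Suc k)"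
proof -
  define K where "K = past_factor c"
  define r where "r = 1 - K * (3 - c)"
  note K_bounds = past_factor_bounds[OF c_bounds, folded K_def]
    and r_bounds = past_slope_bounds[OF c_bounds, folded K_def, folded r_def]
  have den_ge: "x * r + r * \<beta> k \<le> r * den k" if "x + \<beta> k \<le> den k" for x
    using mult_left_mono[OF that, of r] r_bounds by (simp add: distrib_left mult.commute)
  have "1 * r \<le> r * den k" using den_gt_one[of k] r_bounds by simp
  note bounds = this eta_ge[of k] eta_le_third[of k] beta_bounds[of k] den_gt_one[of k] K_bounds
    r_bounds
  have "\<epsilon> (Suc k) * past_shift k \<le> r * den k + (1 - K) * \<epsilon> (Suc k)"
  proof (cases rule: step_cases[of k])
    case odd_pos
    have "(1 / 3 - r) * \<beta> k \<le> (1 / 3 - r) * 1" using bounds by (intro mult_left_mono) auto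
    then have "1 / 3 * \<beta> k - r * \<beta> k \<le> 1 / 3 - r" by (simp add: left_diff_distrib)
    then have "1 + \<eta> k \<le> r * den k + (1 - K)" using den_ge[OF odd_pos(4)] bounds by argo
    then show ?thesis using odd_pos by simp
  next
    case odd_neg
    have "2 * r \<le> r * den k" using odd_neg bounds by simp
    then have "- (1 + \<eta> k) \<le> r * den k - (1 - K)" using bounds by argo
    then show ?thesis using odd_neg by simp
  next
    case even_pos
    have "- \<eta> k \<le> r * den k + (1 - K)" using bounds by argo
    then show ?thesis using even_pos by simp
  next
    case even_neg
    have "\<eta> k \<le> (1 + theta) / 3 + (r * \<beta> k - r * theta)"
      using eta_le_theta_line[of r k] r_bounds theta_bounds
      by (simp add: theta_line_def right_diff_distrib)
    then have "\<eta> k \<le> r * den k - (1 - K)" using den_ge[OF even_neg(4)] r_bounds(3) by argo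
    then show ?thesis using even_neg by simp
  qed
  then have "\<eta> (Suc k) \<le> r + (1 - K) * \<beta> (Suc k)" unfolding eta_Suc_le_iff .
  then show ?thesis unfolding K_def[symmetric] by (simp add: r_def algebra_simps)
qed

lemma one_minus_xi_zeta_ge:
  assumes c_nonneg: "0 \<le> c" and diff: "\<xi> (Suc k) - \<zeta> (Suc k) \<le> c"
  shows "(1 - c) * \<xi> k \<le> 1 - \<xi> k - \<zeta> k"
proof -
  define p where "p = n k + \<epsilon> (Suc k) * \<xi> (Suc k)"
  have xi_p: "\<xi> k * p = 1" unfolding p_def by (rule xi_mult_inverse)
  note bounds = xi_pos[of "Suc k"] xi_less_half[of "Suc k"] zeta_nonneg[of "Suc k"]
    zeta_le_xi[of "Suc k"] real_eps_cases[of "Suc k"]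
  have "1 - c \<le> p - 1 - (if odd (n k) then 1 - \<zeta> (Suc k) else \<zeta> (Suc k))"
  proof (cases "odd (n k)")
    case True
    then show ?thesis using digit_odd_ge[OF True] diff bounds by (auto simp: p_def)
  next
    case even: False
    show ?thesis
    proof (cases "n k = 2")
      case True
      then show ?thesis using eps_after_two[OF True] c_nonneg bounds by (simp add: p_def)
    next
      case False
      have "4 \<le> real_of_int (n k)" using digit_even_ge[OF _ False] even by simp
      then show ?thesis using even c_nonneg bounds by (auto simp: p_def)
    qed
  qed
  then have "\<xi> k * (1 - c) \<le> \<xi> k * (p - 1 - (if odd (n k) then 1 - \<zeta> (Suc k) else \<zeta> (Suc k)))"
    using xi_pos[of k] by simp
  also have "\<dots> = 1 - \<xi> k - \<zeta> k" using xi_p by (simp add: zeta_rec[of k] algebra_simps)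
  finally show ?thesis by (simp add: mult.commute)
qed

lemma future_factor_mult_le:
  assumes c_bounds: "0 \<le> c" "c \<le> 1" and diff: "\<xi> (Suc k) - \<zeta> (Suc k) \<le> c" and x_ge: "- 2 \<le> x"
  shows "(1 - c) * (1 + \<xi> k * x) \<le> (1 - \<xi> k - \<zeta> k) * (3 - c + x)"
proof -
  have "(1 - c) * \<xi> k * (2 + x) \<le> (1 - \<xi> k - \<zeta> k) * (2 + x)"
    using one_minus_xi_zeta_ge[OF c_bounds(1) diff] x_ge by (intro mult_right_mono) auto
  moreover have "0 \<le> (1 - c) * (\<xi> k - \<zeta> k)" using c_bounds zeta_le_xi[of k] by simp
  ultimately show ?thesis by (simp add: algebra_simps)
qed

lemma one_minus_eps_beta_add_eta_ge:
  assumes "4 \<le> n k"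
  shows "3 / 10 \<le> 1 - \<epsilon> (Suc k) * (\<beta> (Suc k) + \<eta> (Suc k))"
proof -
  have "1 + past_shift k \<le> 7 / 10 * den k"
  proof (cases "odd (n k)")
    case True
    then have "5 \<le> n k" using assms by (cases "n k = 4") auto
    then show ?thesis
      using True eta_le_third[of k] beta_bounds[of k] by (simp add: past_shift_def den_def)
  next
    case False
    then show ?thesis
      using assms eta_ge[of k] beta_bounds[of k] by (simp add: past_shift_def den_def)
  qed
  then show ?thesis
    using real_eps_cases[of "Suc k"] eta_Suc_le_iff[of k "7 / 10" "- 1"]
      eta_Suc_ge_iff[of "- 7 / 10" "- 1" k] by auto
qed

lemma one_minus_beta_plus_eta_ge:
  assumes "n k \<noteq> 2"
  shows "1 / 2 \<le> 1 - \<beta> (Suc k) + \<eta> (Suc k)"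
proof -
  note bounds = eta_ge[of k] eta_le_third[of k] beta_bounds[of k]
  have "- 1 / 2 * den k + 1 * \<epsilon> (Suc k) \<le> \<epsilon> (Suc k) * past_shift k"
  proof (cases rule: step_cases[of k])
    case even_pos
    then have "4 \<le> n k" using assms digit_even_ge by blast
    then show ?thesis using even_pos bounds by (simp add: den_def field_simps)
  qed (use bounds in simp_all)
  then show ?thesis using eta_Suc_ge_iff[of "- 1 / 2" 1 k] by simp
qed

text \<open>Consecutive cells share vertices.\<close>

lemma cell_value_after_two:
  assumes "n k = 2"
  shows "cell_value (Suc k) 1 (- 1) = cell_value k (- 1) (- 1)"
    and "cell_value (Suc k) (- 1) 1 = cell_value k 1 1"
  using cell_value_next[of k "- 1" "- 1"] cell_value_next[of k 1 1] assms eps_after_two[OF assms]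
  by (simp_all add: next_w_def next_v_def)

lemma cell_value_after_three:
  "n k = 3 \<Longrightarrow> cell_value (Suc k) (- \<epsilon> (Suc k)) 1 = cell_value k (- 1) (- 1)"
  using cell_value_next[of k "- 1" "- 1"] by (simp add: next_w_def next_v_def)

end

definition small_bound :: "real \<Rightarrow> real" where
  "small_bound c = past_factor c * (1 - c)"

lemma small_bound_bounds:
  assumes "0 < c" "c \<le> 1 / 2"
  shows "0 < small_bound c" "small_bound c \<le> 3 / 10"
  using past_factor_bounds[OF assms] assms mult_mono[of "past_factor c" "3 / 10" "1 - c" 1]
  by (simp_all add: small_bound_def)

locale small_offsets = cell_chain +
  fixes c :: real and k0 :: nat
  assumes c_pos: "0 < c" and c_le_half: "c \<le> 1 / 2"
    and xi_minus_zeta_le: "k0 \<le> k \<Longrightarrow> \<xi> k - \<zeta> k \<le> c"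
begin

lemmas past_factor_c = past_factor_bounds[OF c_pos c_le_half]
lemmas small_bound_c = small_bound_bounds[OF c_pos c_le_half]

lemma small_bound_mult_le: "small_bound c * (1 + \<xi> k * \<beta> k) \<le> 9 / 20"
proof -
  have "small_bound c * (1 + \<xi> k * \<beta> k) \<le> 3 / 10 * (3 / 2)"
    using small_bound_c one_add_xi_beta_bounds[of k] by (intro mult_mono) auto
  then show ?thesis by simp
qed

lemma vertex_minus_minus_ge:
  assumes "k0 \<le> k"
  shows "small_bound c \<le> cell_value (Suc k) (- 1) (- 1)"
proof -
  define b where "b = \<beta> (Suc k)"
  have "past_factor c * ((1 - c) * (1 + \<xi> (Suc k) * b))
    \<le> past_factor c * ((1 - \<xi> (Suc k) - \<zeta> (Suc k)) * (3 - c + b))"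
    using past_factor_c c_pos c_le_half xi_minus_zeta_le[of "Suc (Suc k)"] assms
      beta_bounds[of "Suc k"]
    by (intro mult_left_mono future_factor_mult_le) (auto simp: b_def)
  also have "\<dots> = past_factor c * (3 - c + b) * (1 - \<xi> (Suc k) - \<zeta> (Suc k))" by simp
  also have "\<dots> \<le> (1 + b - \<eta> (Suc k)) * (1 - \<xi> (Suc k) - \<zeta> (Suc k))"
    using past_factor_mult_le[OF c_pos c_le_half, of k] xi_less_half[of "Suc k"]
      zeta_le_xi[of "Suc k"]
    unfolding b_def by (intro mult_right_mono) auto
  finally show ?thesis
    using one_add_xi_beta_bounds(1)[of "Suc k"] unfolding cell_value_vertex
    by (simp add: pos_le_divide_eq small_bound_def b_def mult.assoc)
qed

lemma vertex_plus_plus_ge: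
  assumes "k0 \<le> k"
  shows "small_bound c \<le> cell_value (Suc (Suc k)) 1 1"
proof (cases "\<epsilon> (Suc (Suc k)) = - 1 \<and> n (Suc k) = 3")
  case True
  then show ?thesis
    using vertex_minus_minus_ge[OF assms] cell_value_after_three[of "Suc k"] by simp
next
  case False
  define j where "j = Suc (Suc k)"
  have "3 / 10 * (1 + \<xi> j * \<beta> j) \<le> 1 + \<beta> j + \<eta> j"
  proof (cases "\<epsilon> j = 1")
    case True
    then have "0 < \<beta> j" using beta_Suc_pos_iff[of "Suc k"] by (simp add: j_def)
    then have "3 / 10 * (1 + \<xi> j * \<beta> j) \<le> 3 / 10 * (1 + \<beta> j)" using xi_less_half[of j] by simp
    also have "\<dots> \<le> 1 + \<beta> j + \<eta> j" using eta_ge[of j] \<open>0 < \<beta> j\<close> by simp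
    finally show ?thesis .
  next
    case neg: False
    then have eps_neg: "\<epsilon> j = - 1" using eps_cases by blast
    have "4 \<le> n (Suc k)"
      using False eps_neg eps_after_two[of "Suc k"] digit_ge_two[of "Suc k"]
      by (fastforce simp: j_def)
    from one_minus_eps_beta_add_eta_ge[OF this] have "3 / 10 \<le> 1 + \<beta> j + \<eta> j"
      using eps_neg by (simp add: j_def)
    moreover have "\<xi> j * \<beta> j \<le> 0"
      using neg beta_Suc_pos_iff[of "Suc k"] xi_pos[of j]
      by (intro mult_nonneg_nonpos) (auto simp: j_def)
    ultimately show ?thesis by simp
  qed
  moreover have "past_factor c * (1 + \<xi> j * \<beta> j) \<le> 3 / 10 * (1 + \<xi> j * \<beta> j)"
    using past_factor_c one_add_xi_beta_bounds(1)[of j] by (intro mult_right_mono) auto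
  ultimately have "past_factor c * (1 + \<xi> j * \<beta> j) * (1 - c) \<le> (1 + \<beta> j + \<eta> j) * (1 - \<xi> j + \<zeta> j)"
    using xi_minus_zeta_le[of j] assms c_le_half one_add_beta_eta_pos(1)[of j]
    by (intro mult_mono) (auto simp: j_def)
  then show ?thesis
    using one_add_xi_beta_bounds(1)[of j] unfolding j_def[symmetric] cell_value_vertex
    by (simp add: pos_le_divide_eq small_bound_def mult_ac)
qed

lemma vertex_plus_minus_ge:
  assumes "k0 \<le> k"
  shows "small_bound c \<le> cell_value (Suc (Suc k)) 1 (- 1)"
proof (cases "n (Suc k) = 2")
  case True
  then show ?thesis using vertex_minus_minus_ge[OF assms] cell_value_after_two by simp
next
  case False
  define j where "j = Suc (Suc k)"
  have "1 / 2 * 1 \<le> (1 - \<beta> j + \<eta> j) * (1 + \<xi> j - \<zeta> j)"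
    using one_minus_beta_plus_eta_ge[OF False] zeta_le_xi[of j] unfolding j_def
    by (intro mult_mono) auto
  then show ?thesis
    using small_bound_mult_le[of j] one_add_xi_beta_bounds(1)[of j]
    unfolding j_def[symmetric] cell_value_vertex by (simp add: pos_le_divide_eq)
qed

lemma vertex_minus_plus_ge:
  assumes "k0 \<le> k"
  shows "small_bound c \<le> cell_value (Suc (Suc (Suc k))) (- 1) 1"
proof -
  define j where "j = Suc (Suc k)"
  define b where "b = \<beta> (Suc j)"
  have product: ?thesis
    if "small_bound c * (1 + \<xi> (Suc j) * b) \<le> (1 - b - \<eta> (Suc j)) * (1 + \<xi> (Suc j) + \<zeta> (Suc j))"
    using that one_add_xi_beta_bounds(1)[of "Suc j"]
    unfolding b_def j_def cell_value_vertex by (simp add: pos_le_divide_eq)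
  note bounds = xi_pos[of "Suc j"] zeta_nonneg[of "Suc j"]
  consider (two) "n j = 2" | (three) "n j = 3" "\<epsilon> (Suc j) = 1" | (neg) "\<epsilon> (Suc j) = - 1"
    | (ge_four) "4 \<le> n j" "\<epsilon> (Suc j) = 1"
    using digit_ge_two[of j] eps_cases[of "Suc j"] by fastforce
  then show ?thesis
  proof cases
    case two
    then show ?thesis
      using vertex_plus_plus_ge[OF assms] cell_value_after_two(2) by (simp add: j_def)
  next
    case three
    then show ?thesis
      using vertex_minus_minus_ge[of "Suc k"] assms cell_value_after_three[of j]
      by (simp add: j_def)
  next
    case neg
    then have "b \<le> 0" using beta_Suc_pos_iff[of j] by (simp add: b_def)
    then have "2 / 3 * 1 \<le> (1 - b - \<eta> (Suc j)) * (1 + \<xi> (Suc j) + \<zeta> (Suc j))"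
      using eta_le_third[of "Suc j"] bounds unfolding b_def by (intro mult_mono) auto
    then show ?thesis using small_bound_mult_le[of "Suc j"] by (intro product) (simp add: b_def)
  next
    case ge_four
    have "3 / 10 \<le> 1 - b - \<eta> (Suc j)"
      using one_minus_eps_beta_add_eta_ge[OF ge_four(1)] ge_four(2) by (simp add: b_def)
    moreover have "\<xi> (Suc j) * b \<le> \<xi> (Suc j) * 1"
      using bounds beta_bounds[of "Suc j"] unfolding b_def by (intro mult_left_mono) auto
    ultimately show ?thesis
      using small_bound_c bounds one_add_xi_beta_bounds(1)[of "Suc j", folded b_def]
      by (intro product mult_mono) linarith+
  qed
qed

lemma vertices_ge_small_bound: "k0 + 3 \<le> k \<Longrightarrow> vertices_ge (small_bound c) k"
proof -
  assume "k0 + 3 \<le> k"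
  then have "k = Suc (Suc (Suc (k - 3)))" "k0 \<le> k - 3" by auto
  then obtain j where "k = Suc (Suc (Suc j))" "k0 \<le> j" by blast
  then show ?thesis
    using vertex_plus_plus_ge[of "Suc j"] vertex_minus_minus_ge[of "Suc (Suc j)"]
      vertex_plus_minus_ge[of "Suc j"] vertex_minus_plus_ge[of j]
    by (simp add: vertices_ge_def)
qed

end

lemma two_minus_sqrt3_bounds: "1 / 4 < 2 - sqrt 3" "2 - sqrt 3 < 3 / 10"
proof -
  have "sqrt 3 < 7 / 4" by (rule real_less_lsqrt) (auto simp: power2_eq_square)
  then show "1 / 4 < 2 - sqrt 3" by simp
  have "17 / 10 < sqrt 3" by (rule real_less_rsqrt) (auto simp: power2_eq_square)
  then show "2 - sqrt 3 < 3 / 10" by simp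
qed

context cell_chain
begin

text \<open>\<open>2 - sqrt 3\<close> is the fixed point of the branch \<open>n = 4\<close>, \<open>\<epsilon> = -1\<close>.\<close>

lemma xi_minus_zeta_halving_step:
  assumes digit: "3 \<le> n k" and h_nonneg: "0 \<le> h"
    and excess: "\<xi> (Suc k) - \<zeta> (Suc k) - (2 - sqrt 3) \<le> h"
  shows "\<xi> k - \<zeta> k - (2 - sqrt 3) \<le> 1 / 2 * h"
proof -
  define c where "c = 2 - sqrt 3"
  have c_bounds: "1 / 4 < c" "c < 3 / 10" using two_minus_sqrt3_bounds by (auto simp: c_def)
  have fixed_point: "c * c = 4 * c - 1" unfolding c_def by (simp add: algebra_simps)
  define p where "p = n k + \<epsilon> (Suc k) * \<xi> (Suc k)"
  have xi_p: "\<xi> k * p = 1" unfolding p_def by (rule xi_mult_inverse)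
  note bounds = xi_pos[of k] xi_less_half[of k] xi_pos[of "Suc k"] xi_less_half[of "Suc k"]
    zeta_nonneg[of "Suc k"] zeta_le_xi[of "Suc k"] real_eps_cases[of "Suc k"]
  have "\<xi> k - \<zeta> k - c \<le> 1 / 2 * h"
  proof (cases "odd (n k)")
    case True
    have "5 / 2 \<le> p" using digit bounds by (auto simp: p_def)
    then have "\<xi> k * (5 / 2) \<le> \<xi> k * p" using bounds by (intro mult_left_mono) auto
    then have "\<xi> k * \<zeta> (Suc k) \<le> 2 / 5 * (1 / 2)" using xi_p bounds by (intro mult_mono) auto
    then show ?thesis using True c_bounds h_nonneg by (simp add: zeta_rec[of k] algebra_simps)
  next
    case False
    then have "4 \<le> n k" using digit digit_even_ge[of k] by (cases "n k = 2") auto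
    then have "4 - \<xi> (Suc k) \<le> p" using bounds by (auto simp: p_def)
    then have "c * (4 - \<xi> (Suc k)) \<le> c * p" using c_bounds by simp
    moreover have "\<xi> (Suc k) * c \<le> (\<zeta> (Suc k) + c + h) * c"
      using excess c_bounds by (intro mult_right_mono) (auto simp: c_def)
    moreover have "\<zeta> (Suc k) * c \<le> \<zeta> (Suc k) * 1" "h * c \<le> h * 1"
      using c_bounds bounds h_nonneg by (intro mult_left_mono; simp)+
    ultimately have "1 - \<zeta> (Suc k) \<le> c * p + h" using fixed_point by (simp add: algebra_simps)
    then have "\<xi> k * (1 - \<zeta> (Suc k)) \<le> \<xi> k * (c * p + h)"
      using bounds by (intro mult_left_mono) auto
    also have "\<dots> = c * (\<xi> k * p) + \<xi> k * h" by (simp add: algebra_simps)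
    also have "\<dots> \<le> c + 1 / 2 * h"
      unfolding xi_p using mult_right_mono[of "\<xi> k" "1 / 2" h] bounds h_nonneg by simp
    finally show ?thesis using False by (simp add: zeta_rec[of k] algebra_simps)
  qed
  then show ?thesis by (simp only: c_def)
qed

lemma xi_minus_zeta_le_two_minus_sqrt3:
  assumes "\<And>k. k \<ge> k0 \<Longrightarrow> 3 \<le> n k" and "k \<ge> k0"
  shows "\<xi> k - \<zeta> k \<le> 2 - sqrt 3"
proof -
  have "\<xi> k - \<zeta> k - (2 - sqrt 3) \<le> 0"
  proof (rule nonpos_of_halving_step[of k0 "\<lambda>k. \<xi> k - \<zeta> k - (2 - sqrt 3)"])
    show "\<xi> j - \<zeta> j - (2 - sqrt 3) \<le> 1" for j
      using xi_less_half[of j] zeta_nonneg[of j] two_minus_sqrt3_bounds by linarith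
  qed (use assms xi_minus_zeta_halving_step in auto)
  then show ?thesis by simp
qed

end

section \<open>Vertices for partial quotients at least four\<close>

context cell_chain
begin

lemma cell_value_Suc:
  "cell_value (Suc k) w v = \<bar>den k * w + \<epsilon> (Suc k) * (v + past_shift k)\<bar> * \<bar>future_form (Suc k) w v\<bar>
    / (den k + \<epsilon> (Suc k) * \<xi> (Suc k))"
proof -
  have "den k + \<epsilon> (Suc k) * \<xi> (Suc k) = den k * (1 + \<xi> (Suc k) * \<beta> (Suc k))"
    unfolding den_beta[symmetric] by (simp add: algebra_simps)
  then show ?thesis
    unfolding cell_value_def den_past_form[symmetric] using den_gt_one[of k] by (simp add: abs_mult)
qed

lemma vertices_ge_Suc_iff:
  fixes s :: real
  assumes s_eq: "s = \<epsilon> (Suc k)" and D_eq: "D = den k" and u_eq: "u = past_shift k"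
    and x_eq: "x = \<xi> (Suc k)" and z_eq: "z = \<zeta> (Suc k)"
  shows "vertices_ge T (Suc k) \<longleftrightarrow>
      T * (D + s * x) \<le> (D + s * (1 + u)) * (1 - x + z) \<and>
      T * (D + s * x) \<le> (D + s * (1 - u)) * (1 - x - z) \<and>
      T * (D + s * x) \<le> (D - s * (1 - u)) * (1 + x - z) \<and>
      T * (D + s * x) \<le> (D - s * (1 + u)) * (1 + x + z)"
proof -
  have s_cases: "s = 1 \<or> s = - 1" unfolding s_eq by (rule real_eps_cases)
  moreover have "- (D - 1) < u" "u < D - 1"
    using abs_past_shift[of k] unfolding D_eq u_eq by linarith+
  ultimately have past: "\<bar>D + s * (1 + u)\<bar> = D + s * (1 + u)"
    "\<bar>- D + s * (u - 1)\<bar> = D + s * (1 - u)"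
    "\<bar>D + s * (u - 1)\<bar> = D - s * (1 - u)" "\<bar>- D + s * (1 + u)\<bar> = D - s * (1 + u)"
    by auto
  have future: "\<bar>1 - x + z\<bar> = 1 - x + z" "\<bar>- 1 + x + z\<bar> = 1 - x - z" "\<bar>- 1 - x + z\<bar> = 1 + x - z"
    "\<bar>1 + x + z\<bar> = 1 + x + z"
    unfolding x_eq z_eq using xi_pos[of "Suc k"] xi_less_half[of "Suc k"] zeta_nonneg[of "Suc k"]
      zeta_le_xi[of "Suc k"] by auto
  have "0 < D + s * x"
    using s_cases den_gt_one[of k] xi_pos[of "Suc k"] xi_less_half[of "Suc k"]
    by (auto simp: D_eq x_eq)
  then show ?thesis
    unfolding vertices_ge_def using past future
    by (auto simp: cell_value_Suc future_form_def pos_le_divide_eq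
        simp flip: s_eq D_eq u_eq x_eq z_eq)
qed

end

locale large_digits = cell_chain +
  fixes R_even R_odd :: real and k0 :: nat
  assumes even_digit_ge: "k0 \<le> k \<Longrightarrow> even (n k) \<Longrightarrow> R_even \<le> n k"
    and odd_digit_ge: "k0 \<le> k \<Longrightarrow> odd (n k) \<Longrightarrow> R_odd \<le> n k"
    and R_even_ge: "4 \<le> R_even" and R_odd_ge: "5 \<le> R_odd" and R_diff: "\<bar>R_even - R_odd\<bar> = 1"
begin

definition beta_bound :: real where
  "beta_bound = 1 / (min R_even R_odd - 1)"

definition den_even :: real where
  "den_even = R_even - beta_bound"

definition den_odd :: real where
  "den_odd = R_odd - beta_bound"

definition eta_bound :: real where
  "eta_bound = 1 / (den_odd - 2)"

lemma parameter_bounds: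
  "0 < beta_bound" "beta_bound \<le> 1 / 3" "11 / 3 \<le> den_even" "14 / 3 \<le> den_odd"
    "den_even \<le> den_odd + 1" "den_odd \<le> den_even + 1"
    "0 < eta_bound" "eta_bound \<le> 3 / 8"
proof -
  have "3 \<le> min R_even R_odd - 1" using R_even_ge R_odd_ge by simp
  then show "0 < beta_bound" and "beta_bound \<le> 1 / 3"
    by (simp_all add: beta_bound_def field_simps)
  then show "11 / 3 \<le> den_even" and "14 / 3 \<le> den_odd"
    using R_even_ge R_odd_ge by (simp_all add: den_even_def den_odd_def)
  then show "0 < eta_bound" "eta_bound \<le> 3 / 8" by (simp_all add: eta_bound_def field_simps)
  show "den_even \<le> den_odd + 1" "den_odd \<le> den_even + 1"
    using R_diff by (simp_all add: den_even_def den_odd_def)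
qed

lemma digit_ge: "k0 \<le> k \<Longrightarrow> min R_even R_odd \<le> n k"
  using even_digit_ge[of k] odd_digit_ge[of k] by (cases "even (n k)") auto

lemma abs_beta_le:
  assumes "k0 < k"
  shows "\<bar>\<beta> k\<bar> \<le> beta_bound"
proof -
  obtain j where k_eq: "k = Suc j" "k0 \<le> j" using assms by (cases k) auto
  have "min R_even R_odd - 1 \<le> den j"
    using digit_ge[OF k_eq(2)] beta_bounds[of j] by (simp add: den_def)
  then have "1 / den j \<le> beta_bound"
    unfolding beta_bound_def using R_even_ge R_odd_ge by (intro divide_left_mono mult_pos_pos) auto
  then show ?thesis
    unfolding k_eq(1) beta_Suc_eq using real_eps_cases[of "Suc j"] den_gt_one[of j] by auto
qed

lemma den_ge:
  assumes "k0 < k"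
  shows "odd (n k) \<Longrightarrow> den_odd \<le> den k" "even (n k) \<Longrightarrow> den_even \<le> den k"
  using abs_beta_le[OF assms] odd_digit_ge[of k] even_digit_ge[of k] assms
  by (auto simp: den_def den_odd_def den_even_def)

lemma xi_le:
  assumes "k0 \<le> k"
  shows "\<xi> k \<le> beta_bound" "odd (n k) \<Longrightarrow> \<xi> k \<le> 1 / den_odd" "even (n k) \<Longrightarrow> \<xi> k \<le> 1 / den_even"
proof -
  have xi_eq: "\<xi> j = 1 / (n j + \<epsilon> (Suc j) * \<xi> (Suc j))" for j
    by (simp add: inverse_xi[symmetric])
  have xi_le_beta_bound: "\<xi> j \<le> beta_bound" if "k0 \<le> j" for j
  proof -
    have "min R_even R_odd - 1 \<le> n j + \<epsilon> (Suc j) * \<xi> (Suc j)"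
      using digit_ge[OF that] real_eps_cases[of "Suc j"] xi_pos[of "Suc j"] xi_less_half[of "Suc j"]
      by auto
    then show ?thesis
      unfolding xi_eq[of j] beta_bound_def
      using R_even_ge R_odd_ge by (intro divide_left_mono mult_pos_pos) auto
  qed
  then show "\<xi> k \<le> beta_bound" using assms by blast
  have "n k - beta_bound \<le> n k + \<epsilon> (Suc k) * \<xi> (Suc k)"
    using xi_le_beta_bound[of "Suc k"] assms real_eps_cases[of "Suc k"] xi_pos[of "Suc k"]
      parameter_bounds(1) by auto
  then show "odd (n k) \<Longrightarrow> \<xi> k \<le> 1 / den_odd" "even (n k) \<Longrightarrow> \<xi> k \<le> 1 / den_even"
    unfolding xi_eq[of k] using parameter_bounds odd_digit_ge[OF assms] even_digit_ge[OF assms]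
    by (auto intro!: divide_left_mono mult_pos_pos simp: den_odd_def den_even_def)
qed

lemma xi_zeta_le:
  assumes "k0 \<le> k"
  shows "\<xi> k - \<zeta> k \<le> 1 / den_even" "\<xi> k + \<zeta> k \<le> 2 / den_odd"
proof -
  note bounds = parameter_bounds
  have zeta_Suc: "0 \<le> \<zeta> (Suc k)" "\<zeta> (Suc k) \<le> beta_bound"
    using zeta_nonneg[of "Suc k"] zeta_le_xi[of "Suc k"] xi_le(1)[of "Suc k"] assms by auto
  show "\<xi> k - \<zeta> k \<le> 1 / den_even"
  proof (cases "odd (n k)")
    case True
    then have "\<xi> k * \<zeta> (Suc k) \<le> 1 / den_odd * (1 / 3)"
      using xi_le[OF assms] zeta_Suc bounds xi_pos[of k] by (intro mult_mono) auto
    also have "\<dots> \<le> 1 / den_even" using bounds by (simp add: field_simps)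
    finally show ?thesis using True by (simp add: zeta_rec[of k] algebra_simps)
  next
    case False
    then show ?thesis using xi_le(3)[OF assms] zeta_nonneg[of k] by linarith
  qed
  show "\<xi> k + \<zeta> k \<le> 2 / den_odd"
  proof (cases "odd (n k)")
    case True
    then show ?thesis using xi_le(2)[OF assms] zeta_le_xi[of k] by simp
  next
    case False
    then have "\<xi> k * (1 + \<zeta> (Suc k)) \<le> 1 / den_even * (4 / 3)"
      using xi_le[OF assms] zeta_Suc bounds xi_pos[of k] by (intro mult_mono) auto
    also have "\<dots> \<le> 2 / den_odd" using bounds by (simp add: field_simps)
    finally show ?thesis using False by (simp add: zeta_rec[of k] algebra_simps)
  qed
qed

lemma abs_eta_Suc_le:
  assumes "k0 < k"
  shows "\<bar>\<eta> (Suc k)\<bar> \<le> (1 + \<bar>\<eta> k\<bar>) / den_odd"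
proof -
  note bounds = parameter_bounds
  have "\<bar>\<eta> (Suc k)\<bar> * den k = \<bar>past_shift k\<bar>"
    using arg_cong[OF den_eta[of k], of abs] den_gt_one[of k] real_eps_cases[of "Suc k"]
    by (auto simp: abs_mult mult.commute)
  then have abs_eta_eq: "\<bar>\<eta> (Suc k)\<bar> = \<bar>past_shift k\<bar> / den k"
    using den_gt_one[of k] by (simp add: eq_divide_eq)
  show ?thesis
  proof (cases "odd (n k)")
    case True
    then show ?thesis
      unfolding abs_eta_eq
      using den_ge(1)[OF assms] bounds by (intro frac_le) (auto simp: past_shift_def)
  next
    case False
    then have "\<bar>\<eta> (Suc k)\<bar> \<le> \<bar>\<eta> k\<bar> / den_even"
      unfolding abs_eta_eq
      using den_ge(2)[OF assms] bounds by (intro frac_le) (auto simp: past_shift_def)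
    also have "\<dots> \<le> (1 + \<bar>\<eta> k\<bar>) / den_odd"
    proof -
      have "\<bar>\<eta> k\<bar> * den_odd \<le> \<bar>\<eta> k\<bar> * (den_even + 1)" using bounds by (intro mult_left_mono) auto
      then have "\<bar>\<eta> k\<bar> * den_odd \<le> (1 + \<bar>\<eta> k\<bar>) * den_even"
        using abs_beta_eta[of k] bounds by (simp add: algebra_simps)
      then show ?thesis using bounds by (simp add: field_simps)
    qed
    finally show ?thesis .
  qed
qed

text \<open>Two steps of the contraction \<open>y \<mapsto> (1 + y) / den_odd\<close> bring \<open>\<bar>\<eta>\<bar>\<close> from below \<open>1\<close> to below
  \<open>eta_bound\<close>, which slightly exceeds its fixed point \<open>1 / (den_odd - 1)\<close>.\<close>

lemma abs_eta_le:
  assumes "k0 + 3 \<le> k"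
  shows "\<bar>\<eta> k\<bar> \<le> eta_bound"
proof -
  note bounds = parameter_bounds
  have "k = Suc (Suc (k - 2))" "k0 < k - 2" using assms by auto
  then obtain j where k_eq: "k = Suc (Suc j)" "k0 < j" by blast
  have "\<bar>\<eta> (Suc j)\<bar> \<le> (1 + \<bar>\<eta> j\<bar>) / den_odd" using abs_eta_Suc_le[OF k_eq(2)] .
  also have "\<dots> \<le> 2 / den_odd" using abs_beta_eta[of j] bounds by (intro divide_right_mono) auto
  finally have "(1 + \<bar>\<eta> (Suc j)\<bar>) / den_odd \<le> (1 + 2 / den_odd) / den_odd"
    using bounds by (intro divide_right_mono) auto
  also have "\<dots> \<le> eta_bound" unfolding eta_bound_def using bounds by (simp add: field_simps)
  finally show ?thesis using abs_eta_Suc_le[of "Suc j"] k_eq by simp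
qed

lemma beta_minus_eta_cases:
  assumes "k0 + 4 \<le> k"
  obtains (odd) "\<beta> k \<le> 1 / den_odd" "- (eta_bound / den_odd) \<le> \<beta> k - \<eta> k"
    | (even_nonneg) "0 \<le> \<beta> k" "\<beta> k \<le> 1 / den_even" "\<beta> k * (1 - eta_bound) \<le> \<beta> k - \<eta> k"
    | (even_neg) x where "\<beta> k = - x" "0 \<le> x" "x \<le> 1 / den_even"
      "- (x * (1 + eta_bound)) \<le> \<beta> k - \<eta> k"
proof -
  note bounds = parameter_bounds
  obtain j where k_eq: "k = Suc j" "k0 < j" "\<bar>\<eta> j\<bar> \<le> eta_bound"
    using assms abs_eta_le by (cases k) auto
  have abs_beta: "\<bar>\<beta> k\<bar> = 1 / den j"
    unfolding k_eq(1) beta_Suc_eq using real_eps_cases[of "Suc j"] den_gt_one[of j] by auto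
  have eta_eq: "\<eta> k = \<beta> k * past_shift j"
    unfolding k_eq(1) beta_Suc_eq using den_eta[of j] den_gt_one[of j] by (simp add: field_simps)
  show thesis
  proof (cases "odd (n j)")
    case True
    have "1 / den j \<le> 1 / den_odd"
      using den_ge(1)[OF k_eq(2) True] bounds den_gt_one[of j]
      by (intro divide_left_mono mult_pos_pos) auto
    then have abs_beta_le_inverse: "\<bar>\<beta> k\<bar> \<le> 1 / den_odd" unfolding abs_beta .
    then have "\<bar>\<beta> k\<bar> * \<bar>\<eta> j\<bar> \<le> 1 / den_odd * eta_bound" using k_eq bounds by (intro mult_mono) auto
    then have "\<beta> k * \<eta> j \<le> eta_bound / den_odd"
      using abs_ge_self[of "\<beta> k * \<eta> j"] by (simp add: abs_mult)
    then show ?thesis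
      using odd abs_beta_le_inverse True by (simp add: eta_eq past_shift_def algebra_simps)
  next
    case False
    have "1 / den j \<le> 1 / den_even"
      using den_ge(2)[OF k_eq(2)] False bounds den_gt_one[of j]
      by (intro divide_left_mono mult_pos_pos) auto
    then have abs_beta_le_inverse: "\<bar>\<beta> k\<bar> \<le> 1 / den_even" unfolding abs_beta .
    have diff_eq: "\<beta> k - \<eta> k = \<beta> k * (1 + \<eta> j)"
      using False by (simp add: eta_eq past_shift_def algebra_simps)
    show ?thesis
    proof (cases "0 \<le> \<beta> k")
      case True
      then have "\<beta> k * (1 - eta_bound) \<le> \<beta> k * (1 + \<eta> j)" using k_eq by (intro mult_left_mono) auto
      then show ?thesis using even_nonneg True abs_beta_le_inverse diff_eq by simp
    next
      case neg: False
      then have "\<beta> k * (1 + eta_bound) \<le> \<beta> k * (1 + \<eta> j)"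
        using k_eq by (intro mult_left_mono_neg) auto
      then show ?thesis using even_neg[of "- \<beta> k"] neg abs_beta_le_inverse diff_eq by simp
    qed
  qed
qed

lemma mult_excess_le:
  fixes T q x d :: real
  assumes T_bounds: "0 \<le> T" "T \<le> q" and x_bounds: "0 \<le> x" "x \<le> 1 / den_even"
    and d_ge: "x * (1 - eta_bound) \<le> d"
  shows "T * (x - 1 / den_odd) \<le> (d + eta_bound / den_odd) * q"
proof (cases "x \<le> 1 / den_odd")
  case True
  then have "T * (x - 1 / den_odd) \<le> 0" using T_bounds by (intro mult_nonneg_nonpos) auto
  moreover have "0 \<le> x * (1 - eta_bound)" using x_bounds parameter_bounds by simp
  then have "0 \<le> d" using d_ge by (rule order_trans)
  then have "0 \<le> (d + eta_bound / den_odd) * q" using T_bounds parameter_bounds by simp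
  ultimately show ?thesis by linarith
next
  case False
  note bounds = parameter_bounds
  have "eta_bound * den_odd \<le> 3 / 8 * (den_even + 1)" using bounds by (intro mult_mono) auto
  then have "1 / den_even * eta_bound \<le> 1 / den_odd" using bounds by (simp add: field_simps)
  moreover have "x * eta_bound \<le> 1 / den_even * eta_bound"
    using x_bounds bounds by (intro mult_right_mono) auto
  moreover have "0 \<le> eta_bound / den_odd" using bounds by simp
  ultimately have "x - 1 / den_odd \<le> d + eta_bound / den_odd"
    using d_ge by (simp add: right_diff_distrib)
  then have "T * (x - 1 / den_odd) \<le> q * (d + eta_bound / den_odd)"
    using T_bounds False by (intro mult_mono) auto
  then show ?thesis by (simp add: mult.commute)
qed

lemma mult_den_diff_le_of_range:
  fixes N T q r i :: real
  assumes k_ge: "k0 + 4 \<le> k" and N_le: "N \<le> n k" and T_bounds: "0 \<le> T" "T \<le> q"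
    and at_beta_max: "T * (N + 1 / den_odd - r) \<le> (N - i - eta_bound / den_odd) * q"
    and at_beta_min: "T * (N - 1 / den_even - r) \<le> (N - i - (1 + eta_bound) / den_even) * q"
  shows "T * (den k - r) \<le> (den k - i - \<eta> k) * q"
proof -
  note bounds = parameter_bounds
  have q_nonneg: "0 \<le> q" using T_bounds by simp
  have "T * (N + \<beta> k - r) \<le> (N - i + (\<beta> k - \<eta> k)) * q"
    using k_ge
  proof (cases rule: beta_minus_eta_cases)
    case odd
    then have "T * (N + \<beta> k - r) \<le> T * (N + 1 / den_odd - r)"
      using T_bounds by (intro mult_left_mono) auto
    also note at_beta_max
    also have "(N - i - eta_bound / den_odd) * q \<le> (N - i + (\<beta> k - \<eta> k)) * q"
      using odd q_nonneg by (intro mult_right_mono) auto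
    finally show ?thesis .
  next
    case even_nonneg
    then show ?thesis
      using at_beta_max mult_excess_le[OF T_bounds even_nonneg] by (simp add: algebra_simps)
  next
    case (even_neg x)
    have "T * (N - r) \<le> T * (N + 1 / den_odd - r)"
      using T_bounds bounds by (intro mult_left_mono) auto
    also note at_beta_max
    also have "(N - i - eta_bound / den_odd) * q \<le> (N - i) * q"
      using q_nonneg bounds by (intro mult_right_mono) auto
    finally have "0 \<le> (N - i) * q - T * (N - r)" by simp
    moreover have "0 \<le> (N - i) * q - T * (N - r) + 1 / den_even * (T - (1 + eta_bound) * q)"
      using at_beta_min by (simp add: algebra_simps add_divide_distrib)
    ultimately have "0 \<le> (N - i) * q - T * (N - r) + x * (T - (1 + eta_bound) * q)"
      using linear_nonneg_between even_neg(2,3) by blast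
    then have "T * (N + \<beta> k - r) \<le> (N - i - x * (1 + eta_bound)) * q"
      unfolding even_neg(1) by (simp add: algebra_simps)
    also have "\<dots> \<le> (N - i + (\<beta> k - \<eta> k)) * q"
      using even_neg q_nonneg by (intro mult_right_mono) auto
    finally show ?thesis .
  qed
  moreover have "0 \<le> (n k - N) * (q - T)" using N_le T_bounds by simp
  ultimately show ?thesis by (simp add: den_def algebra_simps)
qed

text \<open>The last four conditions are the critical vertex inequalities, those following the sign
  \<open>-1\<close>, at the ends of the ranges of \<open>\<beta>\<close> and \<open>\<eta>\<close>.\<close>

definition admissible :: "real \<Rightarrow> bool" where
  "admissible T \<longleftrightarrow> 0 \<le> T \<and> T \<le> (1 - 1 / den_even) * (1 - 2 / den_odd)
    \<and> T * (R_odd + 1 / den_odd - 1 / den_even)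
        \<le> (R_odd - 2 - eta_bound / den_odd) * (1 - 1 / den_even)
    \<and> T * (R_odd - 1 / den_even - 1 / den_even)
        \<le> (R_odd - 2 - (1 + eta_bound) / den_even) * (1 - 1 / den_even)
    \<and> T * R_even \<le> (R_even - 1 - eta_bound / den_odd) * (1 - 2 / den_odd)
    \<and> T * (R_even - 1 / den_even - 1 / den_odd)
        \<le> (R_even - 1 - (1 + eta_bound) / den_even) * (1 - 2 / den_odd)"

lemma admissible_bounds:
  assumes "admissible T"
  shows "0 \<le> T" "T \<le> (1 - 1 / den_even) * (1 - 2 / den_odd)" "T \<le> 1 - 1 / den_even"
      "T \<le> 1 - 2 / den_odd" "T \<le> 1"
proof -
  have factors: "0 \<le> 1 - 1 / den_even" "1 - 1 / den_even \<le> 1" "0 \<le> 1 - 2 / den_odd"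
    "1 - 2 / den_odd \<le> 1"
    using parameter_bounds by (auto simp: field_simps)
  then have product: "(1 - 1 / den_even) * (1 - 2 / den_odd) \<le> (1 - 1 / den_even) * 1"
    "(1 - 1 / den_even) * (1 - 2 / den_odd) \<le> 1 * (1 - 2 / den_odd)"
    by (intro mult_left_mono mult_right_mono; simp)+
  show "0 \<le> T" and T_le: "T \<le> (1 - 1 / den_even) * (1 - 2 / den_odd)"
    using assms unfolding admissible_def by blast+
  show "T \<le> 1 - 1 / den_even" "T \<le> 1 - 2 / den_odd" using order_trans[OF T_le] product by simp_all
  then show "T \<le> 1" using factors by linarith
qed

lemma mult_den_diff_le_odd:
  assumes T_admissible: "admissible T" and k_ge: "k0 + 4 \<le> k" and odd: "odd (n k)"
    and x_le: "x \<le> 1 / den_even"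
  shows "T * (den k - x) \<le> (den k - 2 - \<eta> k) * (1 - x)"
proof -
  have "T * (den k - 1 / den_even) \<le> (den k - 2 - \<eta> k) * (1 - 1 / den_even)"
    using T_admissible k_ge odd odd_digit_ge[of k] admissible_bounds[OF T_admissible]
    unfolding admissible_def by (intro mult_den_diff_le_of_range[where N = R_odd]) auto
  moreover have "T \<le> 1 * (den k - 2 - \<eta> k)"
    using admissible_bounds(5)[OF T_admissible] den_ge(1)[of k] abs_eta_le[of k] k_ge odd
      parameter_bounds by simp
  ultimately show ?thesis using mult_diff_le_mono[of T "den k" "1 / den_even" _ 1 x] x_le by simp
qed

lemma mult_den_diff_le_even:
  assumes T_admissible: "admissible T" and k_ge: "k0 + 4 \<le> k" and even: "even (n k)"
    and x_le: "x \<le> 2 / den_odd"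
  shows "T * (den k - x / 2) \<le> (den k - 1 - \<eta> k) * (1 - x)"
proof -
  have "T * (den k - 1 / den_odd) \<le> (den k - 1 - \<eta> k) * (1 - 2 / den_odd)"
    using T_admissible k_ge even even_digit_ge[of k] admissible_bounds[OF T_admissible]
    unfolding admissible_def by (intro mult_den_diff_le_of_range[where N = R_even]) auto
  moreover have "T \<le> 2 * (den k - 1 - \<eta> k)"
    using admissible_bounds(5)[OF T_admissible] den_ge(2)[of k] abs_eta_le[of k] k_ge even
      parameter_bounds by simp
  ultimately show ?thesis
    using mult_diff_le_mono[of T "den k" "1 / den_odd" _ 2 "x / 2"] x_le by simp
qed

lemma scaled_den_le:
  assumes k_ge: "k0 + 4 \<le> k" and x_bounds: "0 \<le> x" "x \<le> 1 / 3"
  shows "(1 - 1 / den_even) * (den k + x) \<le> den k - eta_bound"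
    and "even (n k) \<Longrightarrow> (1 - 2 / den_odd) * den k \<le> den k - 1 - eta_bound"
proof -
  note bounds = parameter_bounds
  have "den_even - 1 \<le> den k" using den_ge[of k] k_ge bounds by (cases "odd (n k)") auto
  then have "(den_even - 1) / den_even \<le> den k / den_even"
    using bounds by (intro divide_right_mono) auto
  moreover have "(den_even - 1) / den_even = 1 - 1 / den_even"
    using bounds by (simp add: field_simps)
  moreover have "1 / den_even \<le> 3 / 11" using bounds by (simp add: field_simps)
  moreover have "(1 - 1 / den_even) * (den k + x)
    = den k - den k / den_even + (1 - 1 / den_even) * x"
    by (simp add: algebra_simps)
  moreover have "(1 - 1 / den_even) * x \<le> 1 * x"
    using x_bounds bounds by (intro mult_right_mono) auto
  ultimately show "(1 - 1 / den_even) * (den k + x) \<le> den k - eta_bound"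
    using x_bounds bounds by linarith
  assume "even (n k)"
  then have "11 / 8 * den_odd \<le> 2 * den k" using den_ge(2)[of k] k_ge bounds by simp
  then have "11 / 8 \<le> 2 * den k / den_odd" using bounds by (simp add: field_simps)
  moreover have "(1 - 2 / den_odd) * den k = den k - 2 * den k / den_odd"
    by (simp add: left_diff_distrib)
  ultimately show "(1 - 2 / den_odd) * den k \<le> den k - 1 - eta_bound" using bounds by linarith
qed

lemma factor_nonneg: "0 \<le> 1 - 1 / den_even" "0 \<le> 1 - 2 / den_odd"
  using parameter_bounds by (simp_all add: field_simps)

lemma future_Suc_bounds:
  assumes "k0 \<le> k"
  shows "0 < \<xi> (Suc k)" "\<xi> (Suc k) \<le> 1 / 3" "0 \<le> \<zeta> (Suc k)" "\<zeta> (Suc k) \<le> \<xi> (Suc k)"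
    and "1 - 1 / den_even \<le> 1 - \<xi> (Suc k) + \<zeta> (Suc k)" "1 - 2 / den_odd \<le> 1 - \<xi> (Suc k) - \<zeta> (Suc k)"
  using xi_pos[of "Suc k"] xi_le(1)[of "Suc k"] zeta_nonneg[of "Suc k"] zeta_le_xi[of "Suc k"]
    xi_zeta_le[of "Suc k"] parameter_bounds(2) assms by auto

lemma past_shift_cases:
  assumes "k0 + 3 \<le> k"
  obtains (odd) "odd (n k)" "past_shift k = 1 + \<eta> k" "- eta_bound \<le> \<eta> k" "\<eta> k \<le> eta_bound"
    | (even) "even (n k)" "past_shift k = - \<eta> k" "- eta_bound \<le> \<eta> k" "\<eta> k \<le> eta_bound"
  using abs_eta_le[OF assms] by (cases "odd (n k)") (auto simp: past_shift_def abs_le_iff)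

context
  fixes T :: real and k :: nat
  assumes T_admissible: "admissible T" and k_ge: "k0 + 4 \<le> k"
begin

lemmas T_bounds = admissible_bounds[OF T_admissible]

lemma mult_den_add_le:
  assumes x_bounds: "0 \<le> x" "x \<le> 1 / 3"
  shows "T * (den k + x) \<le> (den k - eta_bound) * (1 - 2 / den_odd)"
    and "T * (den k + x) \<le> den k - eta_bound"
    and "even (n k) \<Longrightarrow> T * (den k + x) \<le> den k - 1 - eta_bound"
proof -
  have den_add_nonneg: "0 \<le> den k + x" using den_gt_one[of k] x_bounds by simp
  have "T * (den k + x) \<le> (1 - 1 / den_even) * (den k + x) * (1 - 2 / den_odd)"
    using mult_right_mono[OF T_bounds(2) den_add_nonneg] by (simp add: mult_ac)
  also have "\<dots> \<le> (den k - eta_bound) * (1 - 2 / den_odd)"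
    using scaled_den_le(1)[OF k_ge x_bounds] factor_nonneg by (intro mult_right_mono) auto
  finally show scaled: "T * (den k + x) \<le> (den k - eta_bound) * (1 - 2 / den_odd)" .
  have "T * (den k + x) \<le> (1 - 1 / den_even) * (den k + x)"
    using T_bounds(3) den_add_nonneg by (intro mult_right_mono) auto
  then show "T * (den k + x) \<le> den k - eta_bound"
    using scaled_den_le(1)[OF k_ge x_bounds] by linarith
  assume even: "even (n k)"
  have "(den k - eta_bound) * (1 - 2 / den_odd) \<le> den k * (1 - 2 / den_odd)"
    using factor_nonneg parameter_bounds by (intro mult_right_mono) auto
  then show "T * (den k + x) \<le> den k - 1 - eta_bound"
    using scaled scaled_den_le(2)[OF k_ge x_bounds even] by (simp add: mult.commute)
qed

lemma mult_den_le_past: "T * den k \<le> den k - 1 - past_shift k"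
proof -
  have "k0 + 3 \<le> k" using k_ge by simp
  then show ?thesis
  proof (cases rule: past_shift_cases)
    case odd
    then show ?thesis
      using mult_den_diff_le_odd[OF T_admissible k_ge odd(1), of 0] parameter_bounds by simp
  next
    case even
    then show ?thesis using mult_den_add_le(3)[of 0] by simp
  qed
qed

lemma vertices_ge_Suc_of_pos:
  assumes eps_pos: "\<epsilon> (Suc k) = 1"
  shows "vertices_ge T (Suc k)"
proof -
  define D where "D = den k"
  define u where "u = past_shift k"
  define x where "x = \<xi> (Suc k)"
  define z where "z = \<zeta> (Suc k)"
  have sign_eq: "(1 :: real) = \<epsilon> (Suc k)" using eps_pos by simp
  have "k0 \<le> k" "k0 + 3 \<le> k" using k_ge by auto
  note future = future_Suc_bounds[OF \<open>k0 \<le> k\<close>, folded x_def z_def]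
  have past: "T * (D + x) \<le> D - 1 + u" "D - eta_bound \<le> D + 1 - u" "- eta_bound \<le> u"
    using \<open>k0 + 3 \<le> k\<close> mult_den_add_le(2,3)[of x] future
    by (cases rule: past_shift_cases; use parameter_bounds in \<open>simp add: D_def u_def\<close>)+
  have D_bounds: "1 < D" "0 \<le> D - 1 + u" "0 \<le> D - 1 - u"
    using den_gt_one[of k] abs_past_shift[of k] by (auto simp: D_def u_def)
  have "T * (D + x) \<le> (D + 1 + u) * (1 - x + z)"
    unfolding mult.commute[of T]
    using past D_bounds future T_bounds parameter_bounds by (intro mult_mono) auto
  moreover have "T * (D + x) \<le> (D + 1 - u) * (1 - x - z)"
    using past D_bounds future factor_nonneg
    by (intro order_trans[OF mult_den_add_le(1)[of x, folded D_def]] mult_mono) auto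
  moreover have "T * (D + x) \<le> (D - 1 + u) * (1 + x - z)"
    using past D_bounds future mult_left_mono[of 1 "1 + x - z" "D - 1 + u"] by simp
  moreover have "T * (D + x) \<le> (D - 1 - u) * (1 + x + z)"
  proof -
    have "T * x * 1 \<le> T * x * D" using T_bounds future D_bounds by (intro mult_left_mono) auto
    then have "T * (D + x) \<le> T * D * (1 + x)" by (simp add: algebra_simps)
    also have "\<dots> \<le> (D - 1 - u) * (1 + x + z)"
      using mult_den_le_past[folded D_def u_def] D_bounds future by (intro mult_mono) auto
    finally show ?thesis .
  qed
  ultimately show ?thesis
    unfolding vertices_ge_Suc_iff[OF sign_eq D_def u_def x_def z_def] by (simp add: algebra_simps)
qed

lemma plus_plus_product_ge:
  "T * (den k - \<xi> (Suc k)) \<le> (den k - 1 - past_shift k) * (1 - \<xi> (Suc k) + \<zeta> (Suc k))"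
proof -
  have "k0 \<le> k" "k0 + 3 \<le> k" using k_ge by auto
  note future = future_Suc_bounds[OF \<open>k0 \<le> k\<close>]
  define y where "y = \<xi> (Suc k) - \<zeta> (Suc k)"
  show ?thesis
    using \<open>k0 + 3 \<le> k\<close>
  proof (cases rule: past_shift_cases)
    case odd
    have "T * (den k - \<xi> (Suc k)) \<le> T * (den k - y)"
      using future T_bounds by (intro mult_left_mono) (auto simp: y_def)
    also have "\<dots> \<le> (den k - 2 - \<eta> k) * (1 - y)"
      using mult_den_diff_le_odd[OF T_admissible k_ge odd(1), of y] future by (simp add: y_def)
    finally show ?thesis using odd by (simp add: y_def algebra_simps)
  next
    case even
    have "T * (den k - \<xi> (Suc k)) \<le> T * den k" using future T_bounds by (intro mult_left_mono) auto
    also have "\<dots> \<le> (1 - 2 / den_odd) * den k * (1 - 1 / den_even)"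
      using mult_right_mono[OF T_bounds(2), of "den k"] den_gt_one[of k] by (simp add: mult_ac)
    also have "\<dots> \<le> (den k - 1 - past_shift k) * (1 - \<xi> (Suc k) + \<zeta> (Suc k))"
    proof (intro mult_mono)
      show "(1 - 2 / den_odd) * den k \<le> den k - 1 - past_shift k"
        using scaled_den_le(2)[OF k_ge, of 0] even by simp
    qed (use future factor_nonneg abs_past_shift[of k] in auto)
    finally show ?thesis .
  qed
qed

lemma minus_minus_product_ge:
  "T * (den k - \<xi> (Suc k)) \<le> (den k - 1 + past_shift k) * (1 - \<xi> (Suc k) - \<zeta> (Suc k))"
proof -
  have "k0 \<le> k" "k0 + 3 \<le> k" using k_ge by auto
  note future = future_Suc_bounds[OF \<open>k0 \<le> k\<close>]
  show ?thesis
    using \<open>k0 + 3 \<le> k\<close>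
  proof (cases rule: past_shift_cases)
    case odd
    have "T * (den k - \<xi> (Suc k)) \<le> T * (den k + 0)"
      using future T_bounds by (intro mult_left_mono) auto
    also have "\<dots> \<le> (den k - eta_bound) * (1 - 2 / den_odd)" by (rule mult_den_add_le(1)) auto
    also have "\<dots> \<le> (den k - 1 + past_shift k) * (1 - \<xi> (Suc k) - \<zeta> (Suc k))"
      using odd future factor_nonneg abs_past_shift[of k] by (intro mult_mono) auto
    finally show ?thesis .
  next
    case even
    define y where "y = \<xi> (Suc k) + \<zeta> (Suc k)"
    have "T * (den k - \<xi> (Suc k)) \<le> T * (den k - y / 2)"
      using future T_bounds by (intro mult_left_mono) (auto simp: y_def)
    also have "\<dots> \<le> (den k - 1 - \<eta> k) * (1 - y)"
      using mult_den_diff_le_even[OF T_admissible k_ge even(1), of y] future by (simp add: y_def)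
    finally show ?thesis using even by (simp add: y_def diff_diff_eq)
  qed
qed

lemma vertices_ge_Suc_of_neg:
  assumes eps_neg: "\<epsilon> (Suc k) = - 1"
  shows "vertices_ge T (Suc k)"
proof -
  define D where "D = den k"
  define u where "u = past_shift k"
  define x where "x = \<xi> (Suc k)"
  define z where "z = \<zeta> (Suc k)"
  have sign_eq: "(- 1 :: real) = \<epsilon> (Suc k)" using eps_neg by simp
  have "k0 \<le> k" "k0 + 3 \<le> k" using k_ge by auto
  note future = future_Suc_bounds[OF \<open>k0 \<le> k\<close>, folded x_def z_def]
  have "D - eta_bound \<le> D + 1 - u" "D - eta_bound \<le> D + 1 + u"
    using \<open>k0 + 3 \<le> k\<close> by (cases rule: past_shift_cases; use parameter_bounds in \<open>simp add: u_def\<close>)+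
  moreover have "0 \<le> D + 1 - u" "0 \<le> D + 1 + u"
    using abs_past_shift[of k] by (auto simp: D_def u_def)
  ultimately have products: "(D - eta_bound) * 1 \<le> (D + 1 - u) * (1 + x - z)"
    "(D - eta_bound) * 1 \<le> (D + 1 + u) * (1 + x + z)"
    using future by (intro mult_mono; simp)+
  have "T * (D - x) \<le> D - eta_bound"
  proof -
    have "T * (D - x) \<le> T * (D + 0)" using future T_bounds by (intro mult_left_mono) auto
    also have "\<dots> \<le> D - eta_bound" using mult_den_add_le(2)[of 0] by (simp add: D_def)
    finally show ?thesis .
  qed
  from this[THEN order_trans]
  have "T * (D - x) \<le> (D + 1 - u) * (1 + x - z)" "T * (D - x) \<le> (D + 1 + u) * (1 + x + z)"
    using products by simp_all
  then show ?thesis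
    using plus_plus_product_ge minus_minus_product_ge
    unfolding vertices_ge_Suc_iff[OF sign_eq D_def u_def x_def z_def]
      D_def[symmetric] u_def[symmetric] x_def[symmetric] z_def[symmetric]
    by (simp add: algebra_simps)
qed

end

lemma vertices_ge_of_admissible:
  assumes "admissible T" and "k0 + 5 \<le> k"
  shows "vertices_ge T k"
proof -
  obtain j where "k = Suc j" "k0 + 4 \<le> j" using assms(2) by (cases k) auto
  then show ?thesis
    using vertices_ge_Suc_of_pos[OF assms(1)] vertices_ge_Suc_of_neg[OF assms(1)]
      eps_cases[of "Suc j"]
    by blast
qed

end

definition even_bound :: "real \<Rightarrow> real" where
  "even_bound R = 1 - 3 / R + 4 / R ^ 2 - 7 / R ^ 3"

definition odd_bound :: "real \<Rightarrow> real" where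
  "odd_bound R = 1 - 3 / R + 3 / R ^ 2 - 6 / R ^ 3"

context large_digits
begin

text \<open>Here \<open>den_even = s / x\<close>, \<open>den_odd = p / x\<close> and \<open>eta_bound = x / g\<close>; the five inequalities
  are those of \<open>admissible\<close> with the denominators cleared.\<close>

lemma admissible_divide:
  fixes T M x s p g :: real
  assumes x_eq: "x = min R_even R_odd - 1" and s_eq: "s = R_even * x - 1"
    and p_eq: "p = R_odd * x - 1" and g_eq: "g = p - 2 * x" and T_nonneg: "0 \<le> T" and M_pos: "0 < M"
    and product: "T * s * p \<le> M * (s - x) * g"
    and odd_pos: "T * g * (R_odd * p * s + x * s - x * p)
      \<le> M * (s - x) * ((R_odd - 2) * g * p - x * x)"
    and odd_neg: "T * g * s * (R_odd * s - 2 * x)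
      \<le> M * (s - x) * ((R_odd - 2) * g * s - (g + x) * x)"
    and even_pos: "T * R_even * p * p \<le> M * ((R_even - 1) * g * p - x * x)"
    and even_neg: "T * (R_even * p * s - x * p - x * s) \<le> M * ((R_even - 1) * g * s - (g + x) * x)"
  shows "admissible (T / M)"
proof -
  have x_pos: "0 < x" using R_even_ge R_odd_ge by (simp add: x_eq)
  have beta_bound_eq: "beta_bound = 1 / x" by (simp add: beta_bound_def x_eq)
  have den_eq: "den_even = s / x" "den_odd = p / x"
    unfolding den_even_def den_odd_def beta_bound_eq using x_pos by (simp_all add: s_eq p_eq field_simps)
  have g_divide_x: "g / x = den_odd - 2" using x_pos by (simp add: den_eq g_eq field_simps)
  have "0 < s / x" "0 < p / x" "0 < g / x"
    using parameter_bounds unfolding den_eq[symmetric] g_divide_x by simp_all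
  then have all_pos: "0 < x" "0 < s" "0 < p" "0 < g" "0 < M"
    using x_pos M_pos by (simp_all add: zero_less_divide_iff)
  have eta_bound_eq: "eta_bound = x / g" unfolding eta_bound_def g_divide_x[symmetric] by simp
  have factor: "1 - 1 / den_even = (s - x) / s" "1 - 2 / den_odd = g / p"
    using all_pos by (simp_all add: den_eq g_eq diff_divide_distrib)
  show ?thesis
    unfolding admissible_def factor unfolding den_eq eta_bound_eq
  proof (intro conjI)
    show "0 \<le> T / M" using T_nonneg M_pos by simp
    show "T / M \<le> (s - x) / s * (g / p)"
      using product all_pos by (simp add: field_simps)
    show "T / M * (R_odd + 1 / (p / x) - 1 / (s / x))
      \<le> (R_odd - 2 - x / g / (p / x)) * ((s - x) / s)"
      by (rule le_of_diff_eq_divide[where M = "M * g * p * s",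
            OF _ iffD2[OF diff_ge_0_iff_ge odd_pos]]) (use all_pos in \<open>simp_all add: field_simps\<close>)
    show "T / M * (R_odd - 1 / (s / x) - 1 / (s / x))
      \<le> (R_odd - 2 - (1 + x / g) / (s / x)) * ((s - x) / s)"
      by (rule le_of_diff_eq_divide[where M = "M * g * s * s",
            OF _ iffD2[OF diff_ge_0_iff_ge odd_neg]]) (use all_pos in \<open>simp_all add: field_simps\<close>)
    show "T / M * R_even \<le> (R_even - 1 - x / g / (p / x)) * (g / p)"
      by (rule le_of_diff_eq_divide[where M = "M * p * p",
            OF _ iffD2[OF diff_ge_0_iff_ge even_pos]]) (use all_pos in \<open>simp_all add: field_simps\<close>)
    show "T / M * (R_even - 1 / (s / x) - 1 / (p / x))
      \<le> (R_even - 1 - (1 + x / g) / (s / x)) * (g / p)"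
      by (rule le_of_diff_eq_divide[where M = "M * p * s",
            OF _ iffD2[OF diff_ge_0_iff_ge even_neg]]) (use all_pos in \<open>simp_all add: field_simps\<close>)
  qed
qed

lemma admissible_even_bound:
  assumes R_odd_eq: "R_odd = R_even + 1"
  shows "admissible (even_bound R_even)"
proof -
  define t where "t = R_even - 4"
  have t_facts: "0 \<le> t" "R_even = 4 + t" "R_odd = 5 + t"
    using R_odd_eq R_even_ge by (simp_all add: t_def)
  have "admissible ((R_even ^ 3 - 3 * R_even ^ 2 + 4 * R_even - 7) / R_even ^ 3)"
    by (rule admissible_divide[where x = "3 + t" and s = "t * t + 7 * t + 11"
          and p = "t * t + 8 * t + 14" and g = "t * t + 6 * t + 8"])
      (use t_facts(1) in \<open>simp_all add: t_facts(2,3) algebra_simps power2_eq_square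
          power3_eq_cube add_pos_nonneg add_nonneg_pos\<close>)
  also have "(R_even ^ 3 - 3 * R_even ^ 2 + 4 * R_even - 7) / R_even ^ 3 = even_bound R_even"
    using R_even_ge by (simp add: even_bound_def field_simps power2_eq_square power3_eq_cube)
  finally show ?thesis .
qed

lemma admissible_odd_bound:
  assumes R_even_eq: "R_even = R_odd + 1"
  shows "admissible (odd_bound R_odd)"
proof -
  define t where "t = R_odd - 5"
  have t_facts: "0 \<le> t" "R_even = 6 + t" "R_odd = 5 + t"
    using R_even_eq R_odd_ge by (simp_all add: t_def)
  have "admissible ((R_odd ^ 3 - 3 * R_odd ^ 2 + 3 * R_odd - 6) / R_odd ^ 3)"
    by (rule admissible_divide[where x = "4 + t" and s = "t * t + 10 * t + 23"
          and p = "t * t + 9 * t + 19" and g = "t * t + 7 * t + 11"])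
      (use t_facts(1) in \<open>simp_all add: t_facts(2,3) algebra_simps power2_eq_square
          power3_eq_cube add_pos_nonneg add_nonneg_pos\<close>)
  also have "(R_odd ^ 3 - 3 * R_odd ^ 2 + 3 * R_odd - 6) / R_odd ^ 3 = odd_bound R_odd"
    using R_odd_ge by (simp add: odd_bound_def field_simps power2_eq_square power3_eq_cube)
  finally show ?thesis .
qed

end

context cell_chain
begin

lemma vertices_ge_even_bound:
  fixes m :: nat
  assumes digit: "\<And>k. k0 \<le> k \<Longrightarrow> int m \<le> n k" and m_even: "4 \<le> m" "even m" and k_ge: "k0 + 5 \<le> k"
  shows "vertices_ge (even_bound m) k"
proof -
  interpret large_digits n \<epsilon> \<xi> \<zeta> \<beta> \<eta> m "m + 1" k0
  proof
    show "m \<le> real_of_int (n k)" if "k0 \<le> k" for k using digit[OF that] by linarith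
    show "m + 1 \<le> real_of_int (n k)" if "k0 \<le> k" "odd (n k)" for k
    proof -
      have "int m \<noteq> n k" using that(2) m_even(2) by (metis even_of_nat)
      then show ?thesis using digit[OF that(1)] by linarith
    qed
  qed (use m_even in auto)
  show ?thesis using vertices_ge_of_admissible[OF admissible_even_bound k_ge] by simp
qed

lemma vertices_ge_odd_bound:
  fixes m :: nat
  assumes digit: "\<And>k. k0 \<le> k \<Longrightarrow> int m \<le> n k" and m_odd: "5 \<le> m" "odd m" and k_ge: "k0 + 5 \<le> k"
  shows "vertices_ge (odd_bound m) k"
proof -
  interpret large_digits n \<epsilon> \<xi> \<zeta> \<beta> \<eta> "m + 1" m k0
  proof
    show "m \<le> real_of_int (n k)" if "k0 \<le> k" for k using digit[OF that] by linarith
    show "m + 1 \<le> real_of_int (n k)" if "k0 \<le> k" "even (n k)" for k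
    proof -
      have "int m \<noteq> n k" using that(2) m_odd(2) by (metis even_of_nat)
      then show ?thesis using digit[OF that(1)] by linarith
    qed
  qed (use m_odd in auto)
  show ?thesis using vertices_ge_of_admissible[OF admissible_odd_bound k_ge] by simp
qed

end

section \<open>The nearest integer continued fraction\<close>

lemma inverse_notin_Rats: "(x :: real) \<notin> \<rat> \<Longrightarrow> 1 / x \<notin> \<rat>"
  using Rats_divide[OF Rats_1, of "1 / x"] by auto

lemma nint_dist_bounds:
  assumes "x \<notin> \<rat>"
  shows "nint_dist x \<notin> \<rat>" "0 < nint_dist x" "nint_dist x < 1 / 2"
proof -
  have "x - of_int (round x) \<notin> \<rat>"
    using assms Rats_add[OF _ Rats_of_int, of "x - of_int (round x)" "round x"] by auto
  then show irrational: "nint_dist x \<notin> \<rat>"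
    using Rats_minus_iff[of "x - of_int (round x)"]
    by (auto simp: nint_dist_def abs_if split: if_splits)
  then have "nint_dist x \<noteq> 0" "nint_dist x \<noteq> 1 / 2"
    by (metis Rats_0, metis Rats_divide Rats_1 Rats_number_of)
  moreover have "nint_dist x \<le> 1 / 2"
    unfolding nint_dist_def using of_int_round_abs_le[of x] by linarith
  ultimately show "0 < nint_dist x" "nint_dist x < 1 / 2" by (simp_all add: nint_dist_def)
qed

lemma eq_ceiling_minus_nint_dist:
  assumes "x \<notin> \<rat>" and "nint_dist x \<noteq> frac x"
  shows "x = of_int \<lceil>x\<rceil> - nint_dist x"
proof -
  have "x \<notin> \<int>" using assms(1) Ints_subset_Rats by blast
  then have "\<lceil>x\<rceil> = \<lfloor>x\<rfloor> + 1" by (simp add: ceiling_altdef) (metis Ints_of_int)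
  moreover have "round x \<noteq> \<lfloor>x\<rfloor>" using assms(2) by (auto simp: nint_dist_def frac_def)
  moreover have "round x = \<lfloor>x\<rfloor> \<or> round x = \<lfloor>x\<rfloor> + 1" unfolding round_def by linarith
  ultimately have "round x = \<lceil>x\<rceil>" by simp
  then show ?thesis by (simp add: nint_dist_def)
qed

locale nicf =
  fixes \<alpha> :: real
  assumes irrational: "\<alpha> \<notin> \<rat>" and pos: "0 < \<alpha>" and less_half: "\<alpha> < 1 / 2"
begin

abbreviation "a \<equiv> nicf_a \<alpha>"
abbreviation "eps \<equiv> nicf_eps \<alpha>"
abbreviation "rem \<equiv> nicf_rem \<alpha>"
abbreviation "lam \<equiv> nicf_lambda \<alpha>"

lemma rem_notin_Rats: "rem k \<notin> \<rat>"
  by (induction k) (auto simp: irrational nint_dist_bounds inverse_notin_Rats)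

lemma rem_bounds: "0 < rem k" "rem k < 1 / 2"
  using pos less_half nint_dist_bounds(2,3)[OF inverse_notin_Rats[OF rem_notin_Rats]]
  by (cases k; simp)+

lemma inverse_rem: "1 / rem k = a (Suc k) + eps (Suc (Suc k)) * rem (Suc k)"
proof (cases "nint_dist (1 / rem k) = frac (1 / rem k)")
  case True
  then show ?thesis by (simp add: frac_def)
next
  case False
  then show ?thesis
    using eq_ceiling_minus_nint_dist[OF inverse_notin_Rats[OF rem_notin_Rats] False] by simp
qed

lemma nicf_eps_cases: "eps (Suc k) = 1 \<or> eps (Suc k) = - 1"
  by (cases k) auto

declare nicf_rem.simps(2) [simp del] nicf_a.simps(2) [simp del] nicf_eps.simps(3) [simp del]

lemma a_bounds: "2 \<le> a (Suc k)" "a (Suc k) = 2 \<Longrightarrow> eps (Suc (Suc k)) = 1"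
proof -
  have "2 < a (Suc k) + eps (Suc (Suc k)) * rem (Suc k)"
    unfolding inverse_rem[symmetric] using rem_bounds[of k] by (simp add: field_simps)
  then show "2 \<le> a (Suc k)" "a (Suc k) = 2 \<Longrightarrow> eps (Suc (Suc k)) = 1"
    using rem_bounds[of "Suc k"] nicf_eps_cases[of "Suc k"] by auto
qed

lemma rem_mult_a: "rem k * a (Suc k) = 1 - eps (Suc (Suc k)) * (rem k * rem (Suc k))"
proof -
  have "rem k * (1 / rem k) = 1" using rem_bounds[of k] by simp
  then show ?thesis unfolding inverse_rem by (simp add: algebra_simps)
qed

definition rem_prod :: "nat \<Rightarrow> real" where
  "rem_prod k = (\<Prod>i<k. rem i)"

lemma rem_prod_simps: "rem_prod 0 = 1" "rem_prod (Suc k) = rem k * rem_prod k"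
  by (simp_all add: rem_prod_def)

lemma rem_prod_pos: "0 < rem_prod k"
  unfolding rem_prod_def using rem_bounds by (intro prod_pos) auto

lemma convergent_error_Suc:
  "nicf_q \<alpha> (Suc k) * \<alpha> - nicf_p \<alpha> (Suc k)
    = - eps (Suc (Suc k)) * rem (Suc k) * (nicf_q \<alpha> k * \<alpha> - nicf_p \<alpha> k)"
proof (induction k)
  case 0
  then show ?case using rem_mult_a[of 0] by (simp add: algebra_simps)
next
  case (Suc k)
  define d where "d i = nicf_q \<alpha> i * \<alpha> - nicf_p \<alpha> i" for i
  have "d (Suc (Suc k)) = a (Suc (Suc k)) * d (Suc k) + eps (Suc (Suc k)) * d k"
    by (simp add: d_def algebra_simps)
  then have "rem (Suc k) * d (Suc (Suc k)) =
      rem (Suc k) * a (Suc (Suc k)) * d (Suc k) + eps (Suc (Suc k)) * rem (Suc k) * d k"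
    by (simp add: algebra_simps)
  also have "eps (Suc (Suc k)) * rem (Suc k) * d k = - d (Suc k)" using Suc by (simp add: d_def)
  also have "rem (Suc k) * a (Suc (Suc k)) * d (Suc k) + - d (Suc k) =
      rem (Suc k) * (- eps (Suc (Suc (Suc k))) * rem (Suc (Suc k)) * d (Suc k))"
    unfolding rem_mult_a by (simp add: algebra_simps)
  finally have "d (Suc (Suc k)) = - eps (Suc (Suc (Suc k))) * rem (Suc (Suc k)) * d (Suc k)"
    using rem_bounds(1)[of "Suc k"] unfolding mult_cancel_left by simp
  then show ?case unfolding d_def .
qed

lemma nicf_D_eq: "nicf_D \<alpha> k = rem_prod (Suc k)"
proof (induction k)
  case 0
  then show ?case using pos by (simp add: nicf_D_def rem_prod_simps)
next
  case (Suc k)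
  have "nicf_D \<alpha> (Suc k) = rem (Suc k) * nicf_D \<alpha> k"
    unfolding nicf_D_def convergent_error_Suc abs_mult
    using nicf_eps_cases[of "Suc k"] rem_bounds[of "Suc k"] by auto
  then show ?case using Suc by (simp add: rem_prod_simps)
qed

lemma rem_prod_add_le: "rem_prod (k + j) \<le> rem_prod k * (1 / 2) ^ j"
proof (induction j)
  case (Suc j)
  have "rem_prod (k + Suc j) = rem (k + j) * rem_prod (k + j)" by (simp add: rem_prod_simps)
  also have "\<dots> \<le> 1 / 2 * (rem_prod k * (1 / 2) ^ j)"
    using Suc rem_bounds[of "k + j"] rem_prod_pos[of "k + j"] by (intro mult_mono) auto
  finally show ?case by simp
qed simp

lemma rem_prod_tendsto_0: "rem_prod \<longlonglongrightarrow> 0"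
proof (rule real_tendsto_sandwich[of "\<lambda>_. 0" _ _ "\<lambda>k. (1 / 2) ^ k"])
  show "\<forall>\<^sub>F k in sequentially. rem_prod k \<le> (1 / 2) ^ k"
    using rem_prod_add_le[of 0] by (simp add: rem_prod_simps)
  show "\<forall>\<^sub>F k in sequentially. 0 \<le> rem_prod k" using rem_prod_pos by (simp add: less_imp_le)
  show "(\<lambda>k. (1 / 2 :: real) ^ k) \<longlonglongrightarrow> 0" by (rule LIMSEQ_realpow_zero) auto
qed simp

definition lam_term :: "nat \<Rightarrow> real" where
  "lam_term i = lam (Suc i) * rem_prod (Suc i)"

definition lam_tail :: "nat \<Rightarrow> real" where
  "lam_tail k = (\<Sum>j. lam_term (j + k))"

lemma abs_lam_term_le: "\<bar>lam_term (j + k)\<bar> \<le> rem_prod k * (1 / 2) ^ Suc j"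
proof -
  have "\<bar>real_of_int (lam i)\<bar> \<le> 1" for i by (simp add: nicf_lambda_def power_abs)
  then have "\<bar>lam_term (j + k)\<bar> \<le> 1 * rem_prod (Suc (j + k))"
    unfolding lam_term_def abs_mult using rem_prod_pos[of "Suc (j + k)"] by (intro mult_mono) auto
  also have "\<dots> \<le> rem_prod k * (1 / 2) ^ Suc j"
    using rem_prod_add_le[of k "Suc j"] by (simp add: add.commute)
  finally show ?thesis .
qed

lemma rem_prod_half_sums: "(\<lambda>j. rem_prod k * (1 / 2) ^ Suc j) sums rem_prod k"
  using sums_mult[OF power_half_series, of "rem_prod k"] by simp

lemma summable_lam_term: "summable (\<lambda>j. lam_term (j + k))"
  by (rule summable_comparison_test[OF _ sums_summable[OF rem_prod_half_sums[of k]]])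
    (use abs_lam_term_le in auto)

lemma lam_tail_Suc: "lam_tail k = lam_term k + lam_tail (Suc k)"
  unfolding lam_tail_def using suminf_split_head[OF summable_lam_term[of k]] by simp

lemma abs_lam_tail_le: "\<bar>lam_tail k\<bar> \<le> rem_prod k"
proof -
  have "norm (lam_tail k) \<le> (\<Sum>j. rem_prod k * (1 / 2) ^ Suc j)"
    unfolding lam_tail_def
    by (rule norm_suminf_le[OF _ sums_summable[OF rem_prod_half_sums]])
      (use abs_lam_term_le in auto)
  then show ?thesis using sums_unique[OF rem_prod_half_sums[of k]] by simp
qed

lemma gamma_star_eq: "2 * gamma_star \<alpha> = 1 + \<alpha> + lam_tail 0"
proof -
  define h where "h i = rem_prod i + eps (Suc i) * rem_prod (Suc i)" for i
  have "\<bar>eps (Suc i) * rem_prod (Suc i)\<bar> = rem_prod (Suc i)" for i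
    using nicf_eps_cases[of i] rem_prod_pos[of "Suc i"] by (auto simp: abs_mult)
  then have "(\<lambda>i. \<bar>eps (Suc i) * rem_prod (Suc i)\<bar>) \<longlonglongrightarrow> 0"
    using LIMSEQ_Suc[OF rem_prod_tendsto_0] by simp
  then have "(\<lambda>i. eps (Suc i) * rem_prod (Suc i)) \<longlonglongrightarrow> 0"
    by (rule tendsto_rabs_zero_cancel)
  from tendsto_add[OF rem_prod_tendsto_0 this] have h_lim: "h \<longlonglongrightarrow> 0"
    by (simp add: h_def[abs_def])
  have "(a (Suc i) - 1 + eps (Suc i)) * rem_prod (Suc i) = h i - h (Suc i)" for i
  proof -
    have "a (Suc i) * rem_prod (Suc i) = (rem i * a (Suc i)) * rem_prod i"
      by (simp add: rem_prod_simps)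
    also have "\<dots> = rem_prod i - eps (Suc (Suc i)) * rem_prod (Suc (Suc i))"
      unfolding rem_mult_a by (simp add: rem_prod_simps algebra_simps)
    finally show ?thesis by (simp add: h_def algebra_simps)
  qed
  then have "(\<lambda>i. (a (Suc i) - 1 + eps (Suc i)) * rem_prod (Suc i)) sums (h 0 - 0)"
    using telescope_sums'[OF h_lim] by simp
  moreover have "lam_term sums lam_tail 0"
    using summable_sums[OF summable_lam_term[of 0]] by (simp add: lam_tail_def)
  ultimately have "(\<lambda>i. 1 / 2 * ((a (Suc i) - 1 + eps (Suc i)) * rem_prod (Suc i) + lam_term i))
      sums (1 / 2 * (h 0 - 0 + lam_tail 0))"
    by (intro sums_mult sums_add)
  also have "(\<lambda>i. 1 / 2 * ((a (Suc i) - 1 + eps (Suc i)) * rem_prod (Suc i) + lam_term i)) =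
     (\<lambda>i. 1 / 2 * of_int (a (Suc i) - 1 + eps (Suc i) + lam (Suc i)) * nicf_D \<alpha> i)"
    by (simp add: lam_term_def nicf_D_eq algebra_simps)
  finally have "gamma_star \<alpha> = 1 / 2 * (h 0 - 0 + lam_tail 0)"
    unfolding gamma_star_def by (rule sums_unique[symmetric])
  then show ?thesis by (simp add: h_def rem_prod_simps)
qed

definition odd_sign :: "nat \<Rightarrow> real" where
  "odd_sign k = (- 1) ^ card {i \<in> {1..k}. odd (a i)}"

lemma odd_sign_Suc: "odd_sign (Suc k) = (if odd (a (Suc k)) then - odd_sign k else odd_sign k)"
proof -
  have "{i \<in> {1..Suc k}. odd (a i)} =
      (if odd (a (Suc k)) then insert (Suc k) {i \<in> {1..k}. odd (a i)} else {i \<in> {1..k}. odd (a i)})"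
    by (auto simp: le_Suc_eq)
  then show ?thesis by (simp add: odd_sign_def)
qed

lemma odd_sign_mult_self: "odd_sign k * odd_sign k = 1"
  by (simp add: odd_sign_def flip: power_add mult_2)

definition offset :: "nat \<Rightarrow> real" where
  "offset k = - odd_sign k * lam_tail k / rem_prod k"

lemma offset_rec:
  "offset k = rem k * (if odd (a (Suc k)) then 1 - offset (Suc k) else offset (Suc k))"
proof -
  have nonzero: "rem k \<noteq> 0" "rem_prod k \<noteq> 0" using rem_bounds[of k] rem_prod_pos[of k] by auto
  have "lam (Suc k) = (if odd (a (Suc k)) then odd_sign (Suc k) else 0)"
    by (simp add: nicf_lambda_def odd_sign_def)
  then have "odd_sign k * lam_term k = (if odd (a (Suc k)) then - rem_prod (Suc k) else 0)"
    using odd_sign_mult_self[of k] by (simp add: lam_term_def odd_sign_Suc)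
  then have "offset k
    = ((if odd (a (Suc k)) then rem_prod (Suc k) else 0) - odd_sign k * lam_tail (Suc k))
        / rem_prod k"
    unfolding offset_def lam_tail_Suc[of k] by (simp add: algebra_simps)
  then show ?thesis using nonzero by (simp add: offset_def odd_sign_Suc rem_prod_simps field_simps)
qed

text \<open>Both branches of the recursion map the unit interval into itself and halve the distance to
  it.\<close>

lemma offset_unit: "0 \<le> offset k" "offset k \<le> 1"
proof -
  have "max (- offset k) (offset k - 1) \<le> 0"
  proof (rule nonpos_of_halving_step[of 0 "\<lambda>k. max (- offset k) (offset k - 1)"])
    fix k
    have "\<bar>offset k\<bar> \<le> 1"
      using abs_lam_tail_le[of k] rem_prod_pos[of k]
      by (simp add: offset_def odd_sign_def abs_mult power_abs)
    then show "max (- offset k) (offset k - 1) \<le> 1" by auto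
  next
    fix k and h :: real
    assume h_nonneg: "0 \<le> h" and Suc_le: "max (- offset (Suc k)) (offset (Suc k) - 1) \<le> h"
    define y where "y = (if odd (a (Suc k)) then 1 - offset (Suc k) else offset (Suc k))"
    have "- h \<le> y" "y \<le> 1 + h" using Suc_le by (auto simp: y_def)
    then have "rem k * (- h) \<le> rem k * y" "rem k * y \<le> rem k * (1 + h)"
      using rem_bounds[of k] by (intro mult_left_mono; simp)+
    moreover have "rem k * h \<le> 1 / 2 * h"
      using rem_bounds[of k] h_nonneg by (intro mult_right_mono) auto
    moreover have "offset k = rem k * y" unfolding y_def by (rule offset_rec)
    ultimately show "max (- offset k) (offset k - 1) \<le> 1 / 2 * h"
      using rem_bounds[of k] by (intro max.boundedI) (simp_all add: distrib_left)
  qed simp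
  then show "0 \<le> offset k" "offset k \<le> 1" by auto
qed

lemma offset_le_rem: "offset k \<le> rem k"
proof -
  have "rem k * (if odd (a (Suc k)) then 1 - offset (Suc k) else offset (Suc k)) \<le> rem k * 1"
    using rem_bounds[of k] offset_unit[of "Suc k"] by (intro mult_left_mono) auto
  then show ?thesis unfolding offset_rec[of k] by simp
qed

primrec past_ratio :: "nat \<Rightarrow> real" where
  "past_ratio 0 = 0"
| "past_ratio (Suc k) = eps (Suc (Suc k)) / (a (Suc k) + past_ratio k)"

primrec past_offset :: "nat \<Rightarrow> real" where
  "past_offset 0 = 0"
| "past_offset (Suc k) = eps (Suc (Suc k)) *
    (if odd (a (Suc k)) then 1 + past_offset k else - past_offset k) / (a (Suc k) + past_ratio k)"

sublocale cell_chain "\<lambda>k. a (Suc k)" "\<lambda>k. eps (Suc k)" rem offset past_ratio past_offset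
proof
  show "1 / rem k = real_of_int (a (Suc k)) + real_of_int (eps (Suc (Suc k))) * rem (Suc k)" for k
    by (rule inverse_rem)
  show "offset k = rem k * (if odd (a (Suc k)) then 1 - offset (Suc k) else offset (Suc k))" for k
    by (rule offset_rec)
qed (use a_bounds nicf_eps_cases rem_bounds offset_unit offset_le_rem in auto)

end

section \<open>The inhomogeneous minimum\<close>

lemma nint_dist_eq_odd_form:
  fixes \<alpha> z :: real and n :: int
  obtains w v :: int where "odd w" "odd v" "\<bar>w\<bar> \<le> 2 * \<bar>n\<bar> + 1"
    "nint_dist (of_int n * \<alpha> - (1 + \<alpha> - z) / 2) = \<bar>v - \<alpha> * w + z\<bar> / 2"
proof
  define m where "m = round (of_int n * \<alpha> - (1 + \<alpha> - z) / 2)"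
  have "real_of_int (- 1 - 2 * m) - \<alpha> * real_of_int (1 - 2 * n) + z
      = 2 * (of_int n * \<alpha> - (1 + \<alpha> - z) / 2 - of_int m)" by (simp add: field_simps)
  then show "nint_dist (of_int n * \<alpha> - (1 + \<alpha> - z) / 2)
      = \<bar>real_of_int (- 1 - 2 * m) - \<alpha> * real_of_int (1 - 2 * n) + z\<bar> / 2"
    by (simp only: nint_dist_def m_def abs_mult) simp
qed auto

lemma quotient_le_half_product:
  fixes T c d x :: real
  assumes c_pos: "0 < c" and d_nonneg: "0 \<le> d" and x_bounds: "\<bar>T\<bar> / (2 * c) < x" "0 < x"
    and small: "d < c \<Longrightarrow> T \<le> (2 * x + 1) * d"
  shows "T * x / (4 * x + 2) \<le> x * (d / 2)"
proof -
  have "T \<le> d / 2 * (4 * x + 2)"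
  proof (cases "d < c")
    case True
    then show ?thesis using small by (simp add: algebra_simps)
  next
    case False
    have "\<bar>T\<bar> \<le> x * (2 * c)" using x_bounds(1) c_pos by (simp add: field_simps)
    also have "\<dots> \<le> x * (2 * d)" using False x_bounds by simp
    also have "\<dots> \<le> d / 2 * (4 * x + 2)" using d_nonneg by (simp add: algebra_simps)
    finally show ?thesis by linarith
  qed
  from mult_left_mono[OF this, of x] have "T * x \<le> x * (d / 2) * (4 * x + 2)"
    using x_bounds by (simp add: mult_ac)
  then show ?thesis using x_bounds by (simp add: pos_divide_le_eq)
qed

lemma inhom_M_ge_of_odd_forms:
  fixes \<alpha> z T :: real
  assumes "\<exists>c>0. \<forall>w v :: int. odd w \<longrightarrow> odd v \<longrightarrow> \<bar>v - \<alpha> * w + z\<bar> < c \<longrightarrow> T \<le> \<bar>w\<bar> * \<bar>v - \<alpha> * w + z\<bar>"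
  shows "ereal (T / 4) \<le> inhom_M \<alpha> ((1 + \<alpha> - z) / 2)"
proof -
  obtain c where c_pos: "0 < c"
    and forms_ge: "\<And>w v :: int. odd w \<Longrightarrow> odd v \<Longrightarrow> \<bar>v - \<alpha> * w + z\<bar> < c
      \<Longrightarrow> T \<le> \<bar>w\<bar> * \<bar>v - \<alpha> * w + z\<bar>"
    using assms by blast
  define \<gamma> where "\<gamma> = (1 + \<alpha> - z) / 2"
  define F where "F = filtercomap (\<lambda>n :: int. \<bar>n\<bar>) at_top"
  define x :: "int \<Rightarrow> real" where "x n = of_int \<bar>n\<bar>" for n
  define g where "g n = T * x n / (4 * x n + 2)" for n
  have x_at_top: "filterlim x at_top F"
    unfolding x_def F_def
    by (rule filterlim_compose[OF filterlim_real_of_int_at_top filterlim_filtercomap])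
  have "((\<lambda>x :: real. T * x / (4 * x + 2)) \<longlongrightarrow> T / 4) at_top" by real_asymp
  from filterlim_compose[OF this x_at_top] have "(g \<longlongrightarrow> T / 4) F"
    by (simp add: g_def[abs_def])
  then have g_lim: "((\<lambda>n. ereal (g n)) \<longlongrightarrow> ereal (T / 4)) F" by simp
  have g_le: "g n \<le> \<bar>of_int n\<bar> * nint_dist (of_int n * \<alpha> - \<gamma>)"
    if n_large: "\<bar>T\<bar> / (2 * c) < x n" "0 < x n" for n
  proof -
    obtain w v :: int where odd_coords: "odd w" "odd v" "\<bar>w\<bar> \<le> 2 * \<bar>n\<bar> + 1"
      and dist: "nint_dist (of_int n * \<alpha> - \<gamma>) = \<bar>v - \<alpha> * w + z\<bar> / 2"
      unfolding \<gamma>_def by (rule nint_dist_eq_odd_form)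
    have "T \<le> (2 * x n + 1) * \<bar>v - \<alpha> * w + z\<bar>" if "\<bar>v - \<alpha> * w + z\<bar> < c"
    proof -
      have "\<bar>real_of_int w\<bar> \<le> 2 * x n + 1" using odd_coords(3) unfolding x_def by linarith
      then show ?thesis
        using forms_ge[OF odd_coords(1,2) that] by (meson abs_ge_zero mult_right_mono order_trans)
    qed
    from quotient_le_half_product[OF c_pos _ n_large this] show ?thesis
      unfolding dist by (simp add: g_def x_def)
  qed
  have "eventually (\<lambda>n. \<bar>T\<bar> / (2 * c) < x n) F" "eventually (\<lambda>n. 0 < x n) F"
    using x_at_top unfolding filterlim_at_top_dense by blast+
  then have g_le_eventually: "eventually (\<lambda>n. g n \<le> \<bar>of_int n\<bar> * nint_dist (of_int n * \<alpha> - \<gamma>)) F"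
    by eventually_elim (rule g_le)
  show ?thesis
    unfolding inhom_M_def le_Liminf_iff F_def[symmetric] \<gamma>_def[symmetric]
  proof (intro allI impI)
    fix y assume "y < ereal (T / 4)"
    with g_lim have "eventually (\<lambda>n. y < ereal (g n)) F" by (rule order_tendstoD(1))
    with g_le_eventually
    show "eventually (\<lambda>n. y < ereal (\<bar>of_int n\<bar> * nint_dist (of_int n * \<alpha> - \<gamma>))) F"
      by eventually_elim (meson ereal_less_eq(3) less_le_trans)
  qed
qed

context nicf
begin

lemma gamma_star_eq_offset: "gamma_star \<alpha> = (1 + \<alpha> - offset 0) / 2"
  using gamma_star_eq by (simp add: offset_def odd_sign_def rem_prod_simps)

lemma inhom_M_ge_of_vertices_ge:
  assumes "\<And>k. k \<ge> K \<Longrightarrow> vertices_ge T k"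
  shows "ereal (T / 4) \<le> inhom_M \<alpha> (gamma_star \<alpha>)"
  unfolding gamma_star_eq_offset
  using inhom_M_ge_of_odd_forms[of \<alpha> "offset 0" T] product_ge_of_vertices_ge[OF assms] by simp

lemma vertices_ge_small_bound_half:
  assumes "3 \<le> k"
  shows "vertices_ge (small_bound (1 / 2)) k"
proof -
  interpret small_offsets
    "\<lambda>k. a (Suc k)" "\<lambda>k. eps (Suc k)" rem offset past_ratio past_offset "1 / 2" 0
  proof
    show "rem k - offset k \<le> 1 / 2" for k using rem_bounds(2)[of k] offset_unit(1)[of k] by linarith
  qed auto
  show ?thesis using vertices_ge_small_bound assms by simp
qed

lemma gamma_star_not_in_module: "\<not> (\<exists>k l :: int. gamma_star \<alpha> = of_int k + \<alpha> * of_int l)"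
proof
  assume "\<exists>k l :: int. gamma_star \<alpha> = of_int k + \<alpha> * of_int l"
  then obtain k l :: int where gamma_eq: "gamma_star \<alpha> = of_int k + \<alpha> * of_int l" by blast
  obtain c where c_facts: "0 < c"
    "\<And>w v. odd w \<Longrightarrow> odd v \<Longrightarrow> \<bar>real_of_int v - rem 0 * w + offset 0\<bar> < c
      \<Longrightarrow> small_bound (1 / 2) \<le> \<bar>w\<bar> * \<bar>v - rem 0 * w + offset 0\<bar>"
    using product_ge_of_vertices_ge[OF vertices_ge_small_bound_half] by blast
  have "real_of_int (2 * k - 1) - rem 0 * (1 - 2 * l) + offset 0 = 0"
    using gamma_star_eq_offset gamma_eq by (simp add: field_simps)
  then have "small_bound (1 / 2) \<le> 0"
    using c_facts(2)[of "1 - 2 * l" "2 * k - 1"] c_facts(1) by simp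
  then show False using small_bound_bounds(1)[of "1 / 2"] by simp
qed

lemma inhom_M_le_inhom_rho: "inhom_M \<alpha> (gamma_star \<alpha>) \<le> inhom_rho \<alpha>"
  unfolding inhom_rho_def using gamma_star_not_in_module by (intro SUP_upper) auto

lemma eventually_a_ge:
  fixes m :: nat
  assumes "nicf_R \<alpha> = ereal m"
  shows "\<exists>k0. \<forall>k\<ge>k0. int m \<le> a (Suc k)"
proof -
  have "ereal (real m - 1) < liminf (\<lambda>i. ereal (of_int (a i)))"
    using assms unfolding nicf_R_def by simp
  from less_LiminfD[OF this] obtain k0 where
    a_greater: "\<And>k. k \<ge> k0 \<Longrightarrow> ereal (real m - 1) < ereal (of_int (a k))"
    unfolding eventually_sequentially by blast
  have "int m \<le> a (Suc k)" if "k \<ge> k0" for k using a_greater[of "Suc k"] that by simp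
  then show ?thesis by blast
qed

end

lemma sqrt13_eq: "sqrt 13 = 2 * theta + 3"
  by (simp add: theta_def field_simps)

lemma small_bound_half: "small_bound (1 / 2) / 4 = bound_two"
proof -
  have "(4 + theta) * (13 + 2 * theta) = 52 + 21 * theta + 2 * (theta * theta)"
    by (simp add: algebra_simps)
  then have "(4 + theta) * (13 + 2 * theta) = 54 + 15 * theta" unfolding theta_mult_self by simp
  then show ?thesis
    unfolding small_bound_def past_factor_def bound_two_def sqrt13_eq
    using theta_bounds by (simp add: field_simps)
qed

lemma bound_three_eq: "bound_three = 1 / 3 * (2 - sqrt 3) * (4 + theta) / (9 + 2 * theta - sqrt 3)"
proof -
  have quotient: "theta\<^sup>2 / (1 - theta) = (1 - 2 * theta) / 3"
    using theta_bounds theta_mult_self by (simp add: field_simps power2_eq_square)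
  have numerator: "1 - 1 / 4 * (1 + theta\<^sup>2 / (1 - theta)) = (4 + theta) / 6"
    unfolding quotient by (simp add: field_simps)
  have denominator: "1 + 1 / 4 * (theta - (sqrt 3 - 1) / 2) = (9 + 2 * theta - sqrt 3) / 8"
    by (simp add: field_simps)
  have "1 / 4 * A * (F / 6 / (G / 8)) = 1 / 3 * A * F / G" for A F G :: real by simp
  then show ?thesis
    unfolding bound_three_def theta_def[symmetric] Let_def numerator denominator .
qed

lemma small_bound_two_minus_sqrt3: "small_bound (2 - sqrt 3) / 4 = bound_three"
proof -
  define t where "t = sqrt 3"
  define f where "f = 4 + theta"
  have t_facts: "t * t = 3" "17 / 10 < t" "t < 7 / 4"
    using two_minus_sqrt3_bounds by (auto simp: t_def)
  have f_bounds: "4 < f" "f < 13 / 3" using theta_bounds by (auto simp: f_def)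
  have "1 * 4 < (1 + t) * f" using t_facts f_bounds by (intro mult_strict_mono) auto
  then have nonzero: "(1 + t) * f - 1 \<noteq> 0" "1 + 2 * f - t \<noteq> 0" using t_facts f_bounds by auto
  have "(t - 1) * (1 + 2 * f - t) = 2 * t + 2 * (f * t) - 1 - 2 * f - t * t"
    by (simp add: algebra_simps)
  moreover have "2 * (2 - t) * ((1 + t) * f - 1)
    = 4 * f + 2 * (f * t) - 2 * f * (t * t) - 4 + 2 * t"
    by (simp add: algebra_simps)
  ultimately have cross: "(t - 1) * (1 + 2 * f - t) = 2 * (2 - t) * ((1 + t) * f - 1)"
    unfolding t_facts(1) by simp
  have "2 / 3 * F / G * S / 4 = 1 / 6 * F * S / G" for F G S :: real by simp
  moreover have "3 - (2 - sqrt 3) = 1 + t" "1 - (2 - sqrt 3) = t - 1" by (simp_all add: t_def)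
  ultimately have "small_bound (2 - sqrt 3) / 4 = 1 / 6 * f * (t - 1) / ((1 + t) * f - 1)"
    unfolding small_bound_def past_factor_def f_def by (simp only:)
  also have "\<dots> = 1 / 3 * (2 - t) * f / (1 + 2 * f - t)"
    unfolding frac_eq_eq[OF nonzero] using cross by algebra
  also have "\<dots> = bound_three" unfolding bound_three_eq by (simp add: f_def t_def)
  finally show ?thesis .
qed

lemma sqrt13_bounds: "3.60555 < sqrt 13" "sqrt 13 < 3.60556"
  by (rule real_less_rsqrt, simp add: power2_eq_square)
    (rule real_less_lsqrt, simp_all add: power2_eq_square)

lemma bound_two_numeral: "27.211 \<le> 1 / bound_two" "1 / bound_two < 27.212"
  using sqrt13_bounds by (simp_all add: bound_two_def)

lemma bound_three_numeral: "20.487 \<le> 1 / bound_three" "1 / bound_three < 20.488"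
proof -
  define t where "t = sqrt 3"
  define s where "s = sqrt 13"
  have s_bounds: "3.60555 < s" "s < 3.60556" unfolding s_def by (rule sqrt13_bounds)+
  have t_bounds: "1.73205 < t" "t < 1.732051"
    unfolding t_def by (rule real_less_rsqrt real_less_lsqrt; simp add: power2_eq_square)+
  define d where "d = (2 - t) * (5 + s)"
  have "d \<le> 0.26795 * 8.60556" "0.267949 * 8.60555 \<le> d"
    unfolding d_def using s_bounds t_bounds by (intro mult_mono; simp)+
  then have d_bounds: "0 < d" "20.487 * d \<le> 6 * (6 + s - t)" "6 * (6 + s - t) < 20.488 * d"
    using s_bounds t_bounds by auto
  have "4 + theta = (5 + s) / 2" "9 + 2 * theta - t = 6 + s - t"
    by (simp_all add: theta_def s_def field_simps)
  moreover have "1 / (1 / 3 * A * (B / 2) / C) = 6 * C / (A * B)" for A B C :: real by simp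
  ultimately have "1 / bound_three = 6 * (6 + s - t) / d"
    unfolding bound_three_eq d_def t_def[symmetric] by (simp only:)
  then show "20.487 \<le> 1 / bound_three" "1 / bound_three < 20.488"
    using d_bounds by (simp_all add: pos_le_divide_eq pos_divide_less_eq)
qed

context nicf
begin

lemma inhom_M_ge_bound_two: "ereal bound_two \<le> inhom_M \<alpha> (gamma_star \<alpha>)"
  using inhom_M_ge_of_vertices_ge[OF vertices_ge_small_bound_half] unfolding small_bound_half .

lemma inhom_M_ge_bound_three:
  assumes "nicf_R \<alpha> = 3"
  shows "ereal bound_three \<le> inhom_M \<alpha> (gamma_star \<alpha>)"
proof -
  have "nicf_R \<alpha> = ereal (3 :: nat)" using assms by (simp add: numeral_eq_ereal)
  then obtain k0 where a_ge_three: "\<And>k. k \<ge> k0 \<Longrightarrow> 3 \<le> a (Suc k)" using eventually_a_ge[of 3] by auto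
  interpret small_offsets
    "\<lambda>k. a (Suc k)" "\<lambda>k. eps (Suc k)" rem offset past_ratio past_offset "2 - sqrt 3" k0
    using two_minus_sqrt3_bounds xi_minus_zeta_le_two_minus_sqrt3[OF a_ge_three]
    by unfold_locales auto
  show ?thesis
    using inhom_M_ge_of_vertices_ge[of "k0 + 3", OF vertices_ge_small_bound]
    unfolding small_bound_two_minus_sqrt3 .
qed

lemma inhom_M_ge_even_bound:
  fixes R :: nat
  assumes "nicf_R \<alpha> = ereal R" "4 \<le> R" "even R"
  shows "ereal (1 / 4 * even_bound R) \<le> inhom_M \<alpha> (gamma_star \<alpha>)"
proof -
  obtain k0 where "\<And>k. k \<ge> k0 \<Longrightarrow> int R \<le> a (Suc k)" using eventually_a_ge[OF assms(1)] by blast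
  from inhom_M_ge_of_vertices_ge[of "k0 + 5", OF vertices_ge_even_bound[OF this assms(2,3)]]
  show ?thesis by simp
qed

lemma inhom_M_ge_odd_bound:
  fixes R :: nat
  assumes "nicf_R \<alpha> = ereal R" "5 \<le> R" "odd R"
  shows "ereal (1 / 4 * odd_bound R) \<le> inhom_M \<alpha> (gamma_star \<alpha>)"
proof -
  obtain k0 where "\<And>k. k \<ge> k0 \<Longrightarrow> int R \<le> a (Suc k)" using eventually_a_ge[OF assms(1)] by blast
  from inhom_M_ge_of_vertices_ge[of "k0 + 5", OF vertices_ge_odd_bound[OF this assms(2,3)]]
  show ?thesis by simp
qed

end

theorem theorem1:
  fixes \<alpha> :: real
  assumes "\<alpha> \<notin> \<rat>" and "0 < \<alpha>" and "\<alpha> < 1 / 2"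
  shows "inhom_rho \<alpha> \<ge> inhom_M \<alpha> (gamma_star \<alpha>)
    \<and> (nicf_R \<alpha> = 2 \<longrightarrow> inhom_M \<alpha> (gamma_star \<alpha>) \<ge> ereal bound_two)
    \<and> (nicf_R \<alpha> = 3 \<longrightarrow> inhom_M \<alpha> (gamma_star \<alpha>) \<ge> ereal bound_three)
    \<and> (\<forall>R::nat. nicf_R \<alpha> = ereal (real R) \<and> R \<ge> 4 \<and> even R \<longrightarrow>
         inhom_M \<alpha> (gamma_star \<alpha>)
           \<ge> ereal (1 / 4 * (1 - 3 / real R + 4 / real R ^ 2 - 7 / real R ^ 3)))
    \<and> (\<forall>R::nat. nicf_R \<alpha> = ereal (real R) \<and> R \<ge> 5 \<and> odd R \<longrightarrow>
         inhom_M \<alpha> (gamma_star \<alpha>)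
           \<ge> ereal (1 / 4 * (1 - 3 / real R + 3 / real R ^ 2 - 6 / real R ^ 3)))
    \<and> 27.211 \<le> 1 / bound_two \<and> 1 / bound_two < 27.212
    \<and> 20.487 \<le> 1 / bound_three \<and> 1 / bound_three < 20.488"
proof -
  interpret nicf \<alpha> using assms by unfold_locales
  show ?thesis
    using inhom_M_le_inhom_rho inhom_M_ge_bound_two inhom_M_ge_bound_three
      inhom_M_ge_even_bound inhom_M_ge_odd_bound bound_two_numeral bound_three_numeral
    unfolding even_bound_def odd_bound_def by blast
qed

end
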